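(* Consider each of the following three choices of a test statistic $T=T(\mathbf{X})$, where $\mathbf{X}$ is a random vector in $\mathbb{R}^n$ with fixed $n$: (i) the Student one-sample $t$-statistic; (ii) the Student two-sample $t$-statistic; (iii) the $F$-statistic for comparison of variances (all defined in the context). For each choice let $\mathcal{G}$ be the corresponding class of continuous probability densities on $\mathbb{R}^n$ defined in the context. Then for any fixed value of $n$ (and of the sample sizes $n_1,n_2$ in cases (ii), (iii)) there exists a functional $K\colon\mathcal{G}\to\mathbb{R}^{+}$ such that for all $g_0,g_1\in\mathcal{G}$ $$\frac{\mathbf{P}(T>u\mid H_1)}{\mathbf{P}(T>u\mid H_0)}=\frac{K_{g_1}}{K_{g_0}}+o(1)\qquad\text{as }u\to\infty,$$ where under $H_j$ the vector $\mathbf{X}$ has joint density $g_j$ ($j=0,1$), and $0<K_{g_0}=K(g_0)<\infty$, $0<K_{g_1}=K(g_1)<\infty$. The functional $K(g)=K_g$ is given by: (i) $$K_g=\frac{2\pi^{n/2}}{\Gamma(n/2)}\int_0^\infty r^{n-1}g(r\mathbf{I})\,dr;$$ (ii) $$K_g=\frac{2\pi^{(n-1)/2}\left(\frac{n_1-1}{\alpha}\right)^{(n_1-1)/2}\left(\frac{n_2-1}{\beta}\right)^{(n_2-1)/2}\left(\frac1{n_1}+\frac1{n_2}\right)^{(n-2)/2}}{\Gamma\left(\frac{n-1}{2}\right)(n-2)^{(n-2)/2}}\int_{-\pi/2}^{\pi/2}\cos(\omega)^{n-2}\int_0^\infty r^{n-1}g\big(r(\cos(\omega-\omega_0)\mathbf{I}_1+\sin(\omega-\omega_0)\mathbf{I}_2)\big)\,dr\,d\omega;$$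 (iii) $$K_g=\frac{\Gamma\left(\frac{n_1-1}{2}\right)(\pi(n_1-1))^{(n_2-1)/2}}{\Gamma\left(\frac{n-2}{2}\right)}\int_{\mathbb{R}^{n_1}}s_1(\mathbf{x})^{n_2-1}\int_{-\infty}^{\infty}g(\mathbf{x},r\mathbf{J})\,dr\,d\mathbf{x}.$$
   Context: Sample variances use the divisor (sample size minus one). (i) One-sample: $n\ge2$, $\mathbf{X}=(X_1,\dots,X_n)$, $T=\sqrt n\,\overline{\mathbf{X}}/S$ with $\overline{\mathbf{X}}$ the sample mean and $S^2$ the sample variance of $\mathbf{X}$. $\mathbf{I}=(1/\sqrt n,\dots,1/\sqrt n)\in\mathbb{R}^n$, $L=\mathrm{span}(\mathbf{I})$. $\mathcal{G}$ is the set of continuous densities $g$ on $\mathbb{R}^n$ such that $g(x\mathbf{I})>0$ for some $x\ge0$, and for some $\varepsilon>0$ $$\int_0^\infty r^{n-1}\sup_{\|\boldsymbol\xi\|<\varepsilon,\ \boldsymbol\xi\in L^\perp}g(r(\mathbf{I}+\boldsymbol\xi))\,dr<\infty.$$ (ii) Two-sample: $n=n_1+n_2$ with $n_1,n_2\ge2$, $\mathbf{X}=(X_1,\dots,X_n)$, $$T=\frac{\frac1{n_1}\sum_{i=1}^{n_1}X_i-\frac1{n_2}\sum_{i=n_1+1}^{n}X_i}{\sqrt{\alpha S_1^2+\beta S_2^2}},\qquad \alpha=\tfrac{n_1-1}{n-2}\left(\tfrac1{n_1}+\tfrac1{n_2}\right),\quad \beta=\tfrac{n_2-1}{n-2}\left(\tfrac1{n_1}+\tfrac1{n_2}\right),$$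 where $S_1^2,S_2^2$ are the sample variances of $(X_1,\dots,X_{n_1})$ and $(X_{n_1+1},\dots,X_n)$. $\mathbf{I}_1\in\mathbb{R}^n$ has its first $n_1$ coordinates equal to $1/\sqrt{n_1}$ and the others $0$; $\mathbf{I}_2\in\mathbb{R}^n$ has its last $n_2$ coordinates equal to $1/\sqrt{n_2}$ and the others $0$; $\omega_0=\arccos\sqrt{n_2/n}$; $L=\mathrm{span}(\mathbf{I}_1,\mathbf{I}_2)$. $\mathcal{G}$ is the set of continuous densities $g$ on $\mathbb{R}^n$ such that $g(r(\cos(\omega-\omega_0)\mathbf{I}_1+\sin(\omega-\omega_0)\mathbf{I}_2))>0$ for some $r\ge0$ and $\omega\in[-\pi/2,\pi/2]$, and for some $\varepsilon>0$ $$\int_{-\pi/2}^{\pi/2}\cos(\omega)^{n-2}\int_0^\infty r^{n-1}\sup_{\|\boldsymbol\xi\|<\varepsilon,\ \boldsymbol\xi\in L^\perp}g\big(r(\cos(\omega-\omega_0)\mathbf{I}_1+\sin(\omega-\omega_0)\mathbf{I}_2+\boldsymbol\xi)\big)\,dr\,d\omega<\infty.$$ (iii) $F$-statistic: $n=n_1+n_2$ with $n_1,n_2\ge2$; the data vector is written $(\mathbf{X},\mathbf{Y})\in\mathbb{R}^{n_1}\times\mathbb{R}^{n_2}$ with joint density $g(\mathbf{x},\mathbf{y})$; $T=S_1^2/S_2^2$ with $S_1^2,S_2^2$ the sample variances of $\mathbf{X}$ and $\mathbf{Y}$. $s_1(\mathbf{x})$ is the sample standard deviation of $\mathbf{x}\in\mathbb{R}^{n_1}$;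 $\mathbf{J}=(1/\sqrt{n_2},\dots,1/\sqrt{n_2})\in\mathbb{R}^{n_2}$; $L=\mathrm{span}(\mathbf{J})\subset\mathbb{R}^{n_2}$. $\mathcal{G}$ is the set of continuous densities $g$ such that $s_1(\mathbf{x})g(\mathbf{x},r\mathbf{J})>0$ for some $\mathbf{x}\in\mathbb{R}^{n_1}$, $r\in\mathbb{R}$, and for some $\varepsilon>0$ $$\int_{\mathbb{R}^{n_1}}s_1(\mathbf{x})^{n_2-1}\int_{-\infty}^\infty\sup_{\|\boldsymbol\xi\|<\varepsilon,\ \boldsymbol\xi\in L^\perp}g(\mathbf{x},r\mathbf{J}+s_1(\mathbf{x})\boldsymbol\xi)\,dr\,d\mathbf{x}<\infty.$$ *)

theory Defs
  imports "HOL-Probability.Probability" "HOL-Library.Landau_Symbols"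
begin

(* Conventions.
   Sample sizes are cardinalities of finite index types: R^n is real^'n with n = CARD('n).
   A pooled sample of size n1 + n2 is a vector over the sum type 'a + 'b, where n1 = CARD('a)
   and n2 = CARD('b); Inl indexes the first n1 coordinates and Inr the last n2.
   Integrals of nonnegative functions (and suprema of densities) are taken in ennreal, so that
   finiteness is a genuine condition. At the points (of measure zero) where a statistic has
   denominator 0, it gets the value 0. *)

section \<open>Common notions\<close>

definition sample_mean :: "real ^ 'k \<Rightarrow> real" where
  "sample_mean x = (\<Sum>i\<in>UNIV. x $ i) / real CARD('k)"

definition sample_var :: "real ^ 'k \<Rightarrow> real" where
  "sample_var x = (\<Sum>i\<in>UNIV. (x $ i - sample_mean x)\<^sup>2) / (real CARD('k) - 1)"

definition sample_sd :: "real ^ 'k \<Rightarrow> real" where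
  "sample_sd x = sqrt (sample_var x)"

definition continuous_density :: "('v::euclidean_space \<Rightarrow> real) \<Rightarrow> bool" where
  "continuous_density g \<longleftrightarrow>
     continuous_on UNIV g \<and> (\<forall>x. 0 \<le> g x) \<and> (\<integral>\<^sup>+ x. ennreal (g x) \<partial>lborel) = 1"

(* The vectors I of the one-sample case and J of the F-statistic. *)
definition diag_dir :: "real ^ 'k" where
  "diag_dir = (\<chi> i. 1 / sqrt (real CARD('k)))"


section \<open>Student one-sample t-statistic\<close>

definition t_one :: "real ^ 'n \<Rightarrow> real" where
  "t_one x = sqrt (real CARD('n)) * sample_mean x / sample_sd x"

definition class_one :: "(real ^ 'n \<Rightarrow> real) set" where
  "class_one = {g. continuous_density g \<and>
     (\<exists>x\<ge>0. g (x *\<^sub>R diag_dir) > 0) \<and>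
     (\<exists>\<epsilon>>0.
       (\<integral>\<^sup>+ r\<in>{0..}. ennreal (r ^ (CARD('n) - 1)) *
          (SUP \<xi>\<in>{\<xi>. norm \<xi> < \<epsilon> \<and> \<xi> \<in> (span {diag_dir})\<^sup>\<bottom>}.
             ennreal (g (r *\<^sub>R (diag_dir + \<xi>)))) \<partial>lborel) < \<infinity>)}"

definition K_one :: "(real ^ 'n \<Rightarrow> real) \<Rightarrow> ennreal" where
  "K_one g =
     (let n = real CARD('n) in
      ennreal (2 * pi powr (n / 2) / Gamma (n / 2)) *
      (\<integral>\<^sup>+ r\<in>{0..}. ennreal (r ^ (CARD('n) - 1) * g (r *\<^sub>R diag_dir)) \<partial>lborel))"


section \<open>Student two-sample t-statistic\<close>

definition sample_fst :: "real ^ ('a::finite + 'b::finite) \<Rightarrow> real ^ 'a" where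
  "sample_fst x = (\<chi> i. x $ Inl i)"

definition sample_snd :: "real ^ ('a::finite + 'b::finite) \<Rightarrow> real ^ 'b" where
  "sample_snd x = (\<chi> j. x $ Inr j)"

definition pool_alpha :: "nat \<Rightarrow> nat \<Rightarrow> real" where
  "pool_alpha n1 n2 =
     (real n1 - 1) / (real (n1 + n2) - 2) * (1 / real n1 + 1 / real n2)"

definition pool_beta :: "nat \<Rightarrow> nat \<Rightarrow> real" where
  "pool_beta n1 n2 =
     (real n2 - 1) / (real (n1 + n2) - 2) * (1 / real n1 + 1 / real n2)"

definition t_two :: "real ^ ('a::finite + 'b::finite) \<Rightarrow> real" where
  "t_two x = (sample_mean (sample_fst x) - sample_mean (sample_snd x)) /
     sqrt (pool_alpha CARD('a) CARD('b) * sample_var (sample_fst x) +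
           pool_beta CARD('a) CARD('b) * sample_var (sample_snd x))"

definition block_dir1 :: "real ^ ('a::finite + 'b::finite)" where
  "block_dir1 = (\<chi> i. case i of Inl _ \<Rightarrow> 1 / sqrt (real CARD('a)) | Inr _ \<Rightarrow> 0)"

definition block_dir2 :: "real ^ ('a::finite + 'b::finite)" where
  "block_dir2 = (\<chi> i. case i of Inl _ \<Rightarrow> 0 | Inr _ \<Rightarrow> 1 / sqrt (real CARD('b)))"

definition omega0 :: "nat \<Rightarrow> nat \<Rightarrow> real" where
  "omega0 n1 n2 = arccos (sqrt (real n2 / real (n1 + n2)))"

definition circle_dir :: "real \<Rightarrow> real ^ ('a::finite + 'b::finite)" where
  "circle_dir \<omega> =
     cos (\<omega> - omega0 CARD('a) CARD('b)) *\<^sub>R block_dir1 +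
     sin (\<omega> - omega0 CARD('a) CARD('b)) *\<^sub>R block_dir2"

definition class_two :: "(real ^ ('a::finite + 'b::finite) \<Rightarrow> real) set" where
  "class_two = {g. continuous_density g \<and>
     (\<exists>r\<ge>0. \<exists>\<omega>\<in>{- pi / 2..pi / 2}. g (r *\<^sub>R circle_dir \<omega>) > 0) \<and>
     (\<exists>\<epsilon>>0.
       (\<integral>\<^sup>+ \<omega>\<in>{- pi / 2..pi / 2}. ennreal (cos \<omega> ^ (CARD('a) + CARD('b) - 2)) *
          (\<integral>\<^sup>+ r\<in>{0..}. ennreal (r ^ (CARD('a) + CARD('b) - 1)) *
             (SUP \<xi>\<in>{\<xi>. norm \<xi> < \<epsilon> \<and> \<xi> \<in> (span {block_dir1, block_dir2})\<^sup>\<bottom>}.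
                ennreal (g (r *\<^sub>R (circle_dir \<omega> + \<xi>)))) \<partial>lborel) \<partial>lborel) < \<infinity>)}"

definition K_two :: "(real ^ ('a::finite + 'b::finite) \<Rightarrow> real) \<Rightarrow> ennreal" where
  "K_two g =
     (let n1 = real CARD('a); n2 = real CARD('b); n = n1 + n2;
          \<alpha> = pool_alpha CARD('a) CARD('b); \<beta> = pool_beta CARD('a) CARD('b) in
      ennreal (2 * pi powr ((n - 1) / 2) *
          ((n1 - 1) / \<alpha>) powr ((n1 - 1) / 2) *
          ((n2 - 1) / \<beta>) powr ((n2 - 1) / 2) *
          (1 / n1 + 1 / n2) powr ((n - 2) / 2) /
        (Gamma ((n - 1) / 2) * (n - 2) powr ((n - 2) / 2))) *
      (\<integral>\<^sup>+ \<omega>\<in>{- pi / 2..pi / 2}. ennreal (cos \<omega> ^ (CARD('a) + CARD('b) - 2)) *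
         (\<integral>\<^sup>+ r\<in>{0..}. ennreal (r ^ (CARD('a) + CARD('b) - 1) * g (r *\<^sub>R circle_dir \<omega>))
            \<partial>lborel) \<partial>lborel))"


section \<open>F-statistic for comparison of variances\<close>

definition f_stat :: "(real ^ 'a) \<times> (real ^ 'b) \<Rightarrow> real" where
  "f_stat z = sample_var (fst z) / sample_var (snd z)"

definition class_F :: "((real ^ 'a) \<times> (real ^ 'b) \<Rightarrow> real) set" where
  "class_F = {g. continuous_density g \<and>
     (\<exists>x r. sample_sd x * g (x, r *\<^sub>R diag_dir) > 0) \<and>
     (\<exists>\<epsilon>>0.
       (\<integral>\<^sup>+ x. ennreal (sample_sd x ^ (CARD('b) - 1)) *
          (\<integral>\<^sup>+ r. (SUP \<xi>\<in>{\<xi>. norm \<xi> < \<epsilon> \<and> \<xi> \<in> (span {diag_dir})\<^sup>\<bottom>}.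
                ennreal (g (x, r *\<^sub>R diag_dir + sample_sd x *\<^sub>R \<xi>))) \<partial>(lborel :: real measure))
          \<partial>lborel) < \<infinity>)}"

definition K_F :: "((real ^ 'a) \<times> (real ^ 'b) \<Rightarrow> real) \<Rightarrow> ennreal" where
  "K_F g =
     (let n1 = real CARD('a); n2 = real CARD('b); n = n1 + n2 in
      ennreal (Gamma ((n1 - 1) / 2) * (pi * (n1 - 1)) powr ((n2 - 1) / 2) /
        Gamma ((n - 2) / 2)) *
      (\<integral>\<^sup>+ x. ennreal (sample_sd x ^ (CARD('b) - 1)) *
         (\<integral>\<^sup>+ r. ennreal (g (x, r *\<^sub>R diag_dir)) \<partial>lborel) \<partial>lborel))"

end

theory Submission
  imports Defs
begin

text \<open>
  In all three cases the event \<open>T > u\<close> says that the component \<open>P x\<close> of the data transversal to a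
  subspace is nonzero and has norm less than \<open>s (Q x) / \<phi> u\<close>, where \<open>Q x\<close> are the coordinates of \<open>x\<close>
  along the subspace and \<open>\<phi> u\<close> is \<open>u\<close> for the two t-statistics and \<open>sqrt u\<close> for the F-statistic.
  Stretching the transversal component by \<open>\<phi> u\<close> multiplies the integral of the density over this event
  by \<open>\<phi> u ^ d\<close>, with \<open>d\<close> the codimension, and turns the domain into the fixed cone
  \<open>0 < norm (P x) < s (Q x)\<close>. By continuity the stretched density tends to its restriction to the
  subspace, and the supremum in the definition of the class is an integrable majorant. Hence
  \<open>\<phi> u ^ d\<close> times the tail probability tends to a constant, independent of the density, times the
  integral of \<open>s ^ d\<close> against the density on the subspace. The functionals \<open>K\<close> are multiples of the
  latter; in the two-sample case it has to be rewritten in polar coordinates of a half plane.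
\<close>

section \<open>Integrals along the fibres of a linear projection\<close>

lemma nn_integral_lborel_affine:
  fixes f :: "'v::euclidean_space \<Rightarrow> ennreal"
  assumes [measurable]: "f \<in> borel_measurable borel" and c: "c \<noteq> 0"
  shows "(\<integral>\<^sup>+x. f x \<partial>lborel) = ennreal (\<bar>c\<bar> ^ DIM('v)) * (\<integral>\<^sup>+x. f (t + c *\<^sub>R x) \<partial>lborel)"
  by (subst lborel_affine[OF c, of t])
    (simp add: nn_integral_density nn_integral_distr nn_integral_cmult)

lemma nn_integral_lborel_translate:
  fixes f :: "'v::euclidean_space \<Rightarrow> ennreal"
  assumes "f \<in> borel_measurable borel"
  shows "(\<integral>\<^sup>+x. f (t + x) \<partial>lborel) = (\<integral>\<^sup>+x. f x \<partial>lborel)"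
  using nn_integral_lborel_affine[OF assms, of 1 t] by simp

lemma nn_integral_lborel_scale:
  fixes f :: "'v::euclidean_space \<Rightarrow> ennreal"
  assumes "f \<in> borel_measurable borel" and "c > 0"
  shows "(\<integral>\<^sup>+x. f x \<partial>lborel) = ennreal (c ^ DIM('v)) * (\<integral>\<^sup>+x. f (c *\<^sub>R x) \<partial>lborel)"
  using nn_integral_lborel_affine[OF assms(1), of c 0] assms(2) by simp

lemma emeasure_lborel_open_nonzero:
  fixes S :: "'v::euclidean_space set"
  assumes "open S" "S \<noteq> {}"
  shows "emeasure lborel S \<noteq> 0"
proof
  assume "emeasure lborel S = 0"
  then have "S \<in> null_sets lborel"
    using assms(1) by auto
  then have "negligible S"
    by (simp add: negligible_iff_null_sets null_sets_completionI)
  then show False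
    using open_not_negligible[OF assms] by simp
qed

text \<open>\<open>Q\<close> reads off coordinates along the subspace \<open>range J\<close>, and
  \<open>Q_J\<close> makes \<open>J\<close> a section of \<open>Q\<close>. The strict inequality of
  dimensions leaves a nontrivial kernel of \<open>Q\<close>, so the codimension is positive.\<close>

locale fibration =
  fixes Q :: "'v::euclidean_space \<Rightarrow> 'm::euclidean_space" and J :: "'m \<Rightarrow> 'v"
  assumes linear_Q: "linear Q" and linear_J: "linear J" and Q_J [simp]: "Q (J z) = z"
    and dim_less: "DIM('m) < DIM('v)"
begin

text \<open>The projection onto the kernel of \<open>Q\<close> along \<open>range J\<close>; it is
  orthogonal in each of the three applications.\<close>

definition P :: "'v \<Rightarrow> 'v" where
  "P x = x - J (Q x)"

lemma linear_P: "linear P"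
  unfolding P_def
  using linear_compose_sub[OF linear_ident linear_compose[OF linear_Q linear_J, unfolded o_def]] .

lemmas maps_simps = linear_add[OF linear_Q] linear_diff[OF linear_Q] linear_cmul[OF linear_Q]
  linear_add[OF linear_P] linear_diff[OF linear_P] linear_cmul[OF linear_P] linear_cmul[OF linear_J]

lemma Q_P [simp]: "Q (P x) = 0" and P_J [simp]: "P (J z) = 0" and decompose: "J (Q x) + P x = x"
  by (simp_all add: P_def linear_diff[OF linear_Q])

lemma measurable_maps [measurable]:
  "Q \<in> borel_measurable borel" "J \<in> borel_measurable borel" "P \<in> borel_measurable borel"
  by (intro borel_measurable_continuous_onI linear_continuous_on;
      use linear_Q linear_J linear_P in \<open>simp add: linear_conv_bounded_linear\<close>)+

text \<open>The argument for uniqueness of Haar measure: insert the factor \<open>indicator C z\<close>, translate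
  \<open>z\<close> by \<open>Q x\<close>, and then translate \<open>x\<close> by \<open>- J z\<close>, which leaves \<open>P x\<close> fixed.\<close>

lemma nn_integral_fibre:
  fixes F :: "'m \<times> 'v \<Rightarrow> ennreal"
  assumes [measurable]: "F \<in> borel_measurable borel" "C \<in> sets borel"
  shows "emeasure lborel C * (\<integral>\<^sup>+x. F (Q x, P x) \<partial>lborel) =
    (\<integral>\<^sup>+x. indicator C (Q x) * (\<integral>\<^sup>+z. F (z, P x) \<partial>lborel) \<partial>lborel)"
proof -
  have [measurable]: "F \<in> borel_measurable (borel \<Otimes>\<^sub>M borel)"
    by (simp add: borel_prod)
  have "emeasure lborel C * (\<integral>\<^sup>+x. F (Q x, P x) \<partial>lborel)
      = (\<integral>\<^sup>+x. (\<integral>\<^sup>+z. F (Q x, P x) * indicator C z \<partial>lborel) \<partial>lborel)"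
    by (simp add: nn_integral_cmult mult.commute nn_integral_multc)
  also have "\<dots> = (\<integral>\<^sup>+x. (\<integral>\<^sup>+z. F (Q x, P x) * indicator C (Q x + z) \<partial>lborel) \<partial>lborel)"
    by (intro nn_integral_cong nn_integral_lborel_translate[symmetric]) measurable
  also have "\<dots> = (\<integral>\<^sup>+z. (\<integral>\<^sup>+x. F (Q x, P x) * indicator C (Q x + z) \<partial>lborel) \<partial>lborel)"
    by (rule lborel_pair.Fubini') measurable
  also have "\<dots> = (\<integral>\<^sup>+z. (\<integral>\<^sup>+x. F (Q (J (- z) + x), P (J (- z) + x)) * indicator C (Q (J (- z) + x) + z) \<partial>lborel) \<partial>lborel)"
    by (intro nn_integral_cong nn_integral_lborel_translate[symmetric]) measurable
  also have "\<dots> = (\<integral>\<^sup>+z. (\<integral>\<^sup>+x. F (Q x + - z, P x) * indicator C (Q x) \<partial>lborel) \<partial>lborel)"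
    by (simp add: maps_simps)
  also have "\<dots> = (\<integral>\<^sup>+x. (\<integral>\<^sup>+z. F (Q x + - z, P x) * indicator C (Q x) \<partial>lborel) \<partial>lborel)"
    by (rule lborel_pair.Fubini'[symmetric]) measurable
  also have "\<dots> = (\<integral>\<^sup>+x. indicator C (Q x) * (\<integral>\<^sup>+z. F (z, P x) \<partial>lborel) \<partial>lborel)"
  proof (rule nn_integral_cong)
    fix x
    have "(\<integral>\<^sup>+z. F (Q x + - z, P x) \<partial>lborel) = (\<integral>\<^sup>+z. F (z, P x) \<partial>lborel)"
      \<comment> \<open>The reflection \<open>z\<close> to \<open>Q x - z\<close> preserves Lebesgue
        measure, so the dependence on \<open>Q x\<close> disappears.\<close>
      using nn_integral_lborel_affine[of "\<lambda>z. F (z, P x)" "-1" "Q x"] by simp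
    then show "(\<integral>\<^sup>+z. F (Q x + - z, P x) * indicator C (Q x) \<partial>lborel)
        = indicator C (Q x) * (\<integral>\<^sup>+z. F (z, P x) \<partial>lborel)"
      by (subst nn_integral_multc) (measurable, simp add: mult.commute)
  qed
  finally show ?thesis .
qed

lemma emeasure_unit_box: "emeasure lborel (box 0 (One::'m)) = 1"
  by (simp add: emeasure_lborel_box)

text \<open>With a set \<open>C\<close> of measure 1 inserted, the first component becomes a free
  variable and \<open>t *\<^sub>R P x = P (t *\<^sub>R x)\<close> depends on
  \<open>t *\<^sub>R x\<close> only. Scaling the whole space costs \<open>t ^ DIM('v)\<close>, and
  the enlarged set \<open>t C\<close> gives back \<open>t ^ DIM('m)\<close>; the codimension is what
  remains.\<close>

lemma nn_integral_scale_fibre: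
  fixes F :: "'m \<times> 'v \<Rightarrow> ennreal"
  assumes [measurable]: "F \<in> borel_measurable borel" and t: "t > 0"
  shows "ennreal (t ^ (DIM('v) - DIM('m))) * (\<integral>\<^sup>+x. F (Q x, t *\<^sub>R P x) \<partial>lborel) = (\<integral>\<^sup>+x. F (Q x, P x) \<partial>lborel)"
proof -
  have [measurable]: "F \<in> borel_measurable (borel \<Otimes>\<^sub>M borel)"
    by (simp add: borel_prod)
  define C where "C = box 0 (One::'m)"
  have C [measurable]: "C \<in> sets borel" and C1: "emeasure lborel C = 1"
    by (simp_all add: C_def emeasure_unit_box)
  \<comment> \<open>This is \<open>C\<close> stretched by \<open>t\<close>, so that
    \<open>Q x\<close> lies in \<open>C\<close> exactly when \<open>Q (t *\<^sub>R x)\<close> lies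
    in \<open>C'\<close>.\<close>
  define C' where "C' = (\<lambda>z. z /\<^sub>R t) -` C"
  have C' [measurable]: "C' \<in> sets borel"
    unfolding C'_def by (rule measurable_sets_borel[OF _ C]) measurable
  have "emeasure lborel C' = (\<integral>\<^sup>+z. indicator C' z \<partial>lborel)"
    by simp
  also have "\<dots> = (\<integral>\<^sup>+z. indicator C (z /\<^sub>R t) \<partial>lborel)"
    by (simp add: C'_def indicator_vimage[unfolded o_def])
  also have "\<dots> = ennreal (t ^ DIM('m)) * (\<integral>\<^sup>+z. indicator C z \<partial>lborel)"
    using t by (subst nn_integral_lborel_scale[OF _ t]) auto
  finally have mC': "emeasure lborel C' = ennreal (t ^ DIM('m))"
    using C1 by simp
  have [measurable]: "(\<lambda>x. F (fst x, t *\<^sub>R snd x)) \<in> borel_measurable borel"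
    unfolding borel_prod[symmetric] by measurable
  have "ennreal (t ^ DIM('v)) * (\<integral>\<^sup>+x. F (Q x, t *\<^sub>R P x) \<partial>lborel) =
        ennreal (t ^ DIM('v)) * (\<integral>\<^sup>+x. indicator C (Q x) * (\<integral>\<^sup>+z. F (z, t *\<^sub>R P x) \<partial>lborel) \<partial>lborel)"
    using nn_integral_fibre[of "\<lambda>x. F (fst x, t *\<^sub>R snd x)" C] C1 by simp
  also have "\<dots> = ennreal (t ^ DIM('v)) * 
      (\<integral>\<^sup>+x. indicator C' (Q (t *\<^sub>R x)) * (\<integral>\<^sup>+z. F (z, P (t *\<^sub>R x)) \<partial>lborel) \<partial>lborel)"
    using t by (intro arg_cong2[where f="(*)"] nn_integral_cong refl)
       (auto simp: C'_def maps_simps split: split_indicator)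
  also have "\<dots> = (\<integral>\<^sup>+x. indicator C' (Q x) * (\<integral>\<^sup>+z. F (z, P x) \<partial>lborel) \<partial>lborel)"
    by (rule nn_integral_lborel_scale[symmetric]) (use t in auto)
  also have "\<dots> = ennreal (t ^ DIM('m)) * (\<integral>\<^sup>+x. F (Q x, P x) \<partial>lborel)"
    using nn_integral_fibre[of F C'] mC' by simp
  finally have "ennreal (t ^ DIM('v)) * (\<integral>\<^sup>+x. F (Q x, t *\<^sub>R P x) \<partial>lborel) =
    ennreal (t ^ DIM('m)) * (\<integral>\<^sup>+x. F (Q x, P x) \<partial>lborel)" .
  moreover have "t ^ DIM('v) = t ^ DIM('m) * t ^ (DIM('v) - DIM('m))"
    using dim_less by (simp flip: power_add)
  ultimately have "ennreal (t ^ DIM('m)) * (ennreal (t ^ (DIM('v) - DIM('m))) * (\<integral>\<^sup>+x. F (Q x, t *\<^sub>R P x) \<partial>lborel)) =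
    ennreal (t ^ DIM('m)) * (\<integral>\<^sup>+x. F (Q x, P x) \<partial>lborel)"
    using t by (simp add: ennreal_mult mult.assoc)
  then show ?thesis
    using t by (subst (asm) ennreal_mult_cancel_left) auto
qed

text \<open>Serves as the volume of the unit ball in the kernel of \<open>Q\<close>. No measure on
  the kernel is set up, so the ball is thickened by the unit box of the base. The origin is removed
  because a statistic with denominator \<open>0\<close> has value \<open>0\<close>.\<close>

definition fibre_const :: ennreal where
  "fibre_const = (\<integral>\<^sup>+x. indicator (box 0 One) (Q x) * indicator {p. 0 < norm p \<and> norm p < 1} (P x) \<partial>lborel)"

text \<open>The region measured is bounded, being contained in a bounded image under
  \<open>J\<close> plus the unit ball, and it is open and nonempty because \<open>Q\<close> has a
  nontrivial kernel.\<close>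

lemma fibre_const_finite: "fibre_const < \<infinity>" and fibre_const_pos: "0 < fibre_const"
proof -
  define S where "S = {x. Q x \<in> box 0 One \<and> P x \<noteq> 0 \<and> norm (P x) < 1}"
  have cont: "continuous_on UNIV Q" "continuous_on UNIV P"
    using linear_Q linear_P by (auto intro: linear_continuous_on simp: linear_conv_bounded_linear)
  have "open S"
  proof -
    have eq: "S = Q -` box 0 One \<inter> P -` (ball 0 1 - {0})"
      by (auto simp: S_def)
    show ?thesis
      unfolding eq by (intro open_Int open_vimage cont open_box open_Diff) auto
  qed
  then have [measurable]: "S \<in> sets borel" by simp
  have "fibre_const = (\<integral>\<^sup>+x. indicator S x \<partial>lborel)"
    unfolding fibre_const_def
    by (intro nn_integral_cong) (auto simp: S_def split: split_indicator)
  then have eq: "fibre_const = emeasure lborel S"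
    by simp
  have "bounded S"
  proof -
    have "bounded (J ` box 0 One)"
      using linear_J by (intro bounded_linear_image bounded_box) (simp add: linear_conv_bounded_linear)
    then obtain B where B: "\<And>z. z \<in> box 0 One \<Longrightarrow> norm (J z) \<le> B"
      by (auto simp: bounded_iff)
    have "norm x \<le> B + 1" if "x \<in> S" for x
      using B[of "Q x"] that norm_triangle_ineq[of "J (Q x)" "P x"] by (auto simp: S_def decompose)
    then show ?thesis by (auto simp: bounded_iff)
  qed
  then show "fibre_const < \<infinity>"
    unfolding eq by (rule emeasure_bounded_finite)
  have "\<not> inj Q"
  proof
    assume "inj Q"
    then have "dim (Q ` UNIV) = dim (UNIV :: 'v set)"
      by (intro dim_image_eq linear_Q) simp
    also have "\<dots> = DIM('v)" by simp
    finally show False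
      using dim_subset_UNIV[of "range Q"] dim_less by simp
  qed
  then obtain p where p: "p \<noteq> 0" "Q p = 0"
    using linear_injective_0[OF linear_Q] by auto
  have Pp: "P p = p"
    using p linear_0[OF linear_J] by (simp add: P_def)
  \<comment> \<open>The centre of the unit box, lifted by \<open>J\<close> and moved by a kernel
    vector of norm \<open>1/2\<close>.\<close>
  have "J ((1/2) *\<^sub>R One) + (1 / (2 * norm p)) *\<^sub>R p \<in> S"
    using p by (auto simp: S_def maps_simps Pp mem_box)
  then have "S \<noteq> {}" by auto
  with \<open>open S\<close> have "emeasure lborel S \<noteq> 0"
    by (rule emeasure_lborel_open_nonzero)
  then show "0 < fibre_const"
    unfolding eq by (simp add: zero_less_iff_neq_zero)
qed

text \<open>By \<open>nn_integral_fibre\<close> the base coordinate may be integrated independently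
  of the transversal one. Over a fixed \<open>z\<close> what is left is a punctured ball of radius
  \<open>s z\<close> in the kernel, whose volume is the power of \<open>s z\<close> to the
  codimension times that of the unit ball.\<close>

lemma nn_integral_cone:
  fixes h :: "'m \<Rightarrow> ennreal" and s :: "'m \<Rightarrow> real"
  assumes [measurable]: "h \<in> borel_measurable borel" "s \<in> borel_measurable borel"
    and s: "\<And>z. 0 \<le> s z"
  shows "(\<integral>\<^sup>+x. h (Q x) * indicator {x. 0 < norm (P x) \<and> norm (P x) < s (Q x)} x \<partial>lborel) =
    fibre_const * (\<integral>\<^sup>+z. h z * ennreal (s z ^ (DIM('v) - DIM('m))) \<partial>lborel)"
proof -
  define C where "C = box 0 (One::'m)"
  have C [measurable]: "C \<in> sets borel" and C1: "emeasure lborel C = 1"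
    by (simp_all add: C_def emeasure_unit_box)
  define U where "U = {p :: 'v. 0 < norm p \<and> norm p < 1}"
  have [measurable]: "U \<in> sets borel" unfolding U_def by measurable
  have inner: "(\<integral>\<^sup>+x. indicator C (Q x) * indicator {p. 0 < norm p \<and> norm p < s z} (P x) \<partial>lborel)
     = ennreal (s z ^ (DIM('v) - DIM('m))) * fibre_const" (is "?I = _") for z
  \<comment> \<open>For \<open>s z = 0\<close> the punctured ball is empty, and
    \<open>0 ^ d = 0\<close> because the codimension \<open>d\<close> is positive.\<close>
  proof (cases "s z = 0")
    case True
    have empty: "{p :: 'v. 0 < norm p \<and> norm p < 0} = {}" by auto
    show ?thesis using dim_less unfolding True empty by simp
  next
    case False
    then have sz: "s z > 0" using s[of z] by simp
    define F where "F = (\<lambda>y::'m\<times>'v. indicator C (fst y) * indicator U (snd y) :: ennreal)"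
    have [measurable]: "F \<in> borel_measurable borel"
      unfolding F_def borel_prod[symmetric] by measurable
    \<comment> \<open>Shrinking the kernel direction by \<open>1 / s z\<close> compares the ball of
      radius \<open>s z\<close> with the unit ball.\<close>
    have "ennreal ((1 / s z) ^ (DIM('v) - DIM('m))) * (\<integral>\<^sup>+x. F (Q x, (1 / s z) *\<^sub>R P x) \<partial>lborel) =
        (\<integral>\<^sup>+x. F (Q x, P x) \<partial>lborel)"
      using sz by (intro nn_integral_scale_fibre) auto
    also have "\<dots> = fibre_const" by (simp add: F_def fibre_const_def C_def U_def)
    also have "(\<integral>\<^sup>+x. F (Q x, (1 / s z) *\<^sub>R P x) \<partial>lborel) = ?I"
      using sz by (intro nn_integral_cong) (auto simp: F_def U_def split: split_indicator)
    finally have scaled: "ennreal ((1 / s z) ^ (DIM('v) - DIM('m))) * ?I = fibre_const" .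
    have "s z ^ (DIM('v) - DIM('m)) * (1 / s z) ^ (DIM('v) - DIM('m)) = 1"
      using sz by (simp add: power_one_over)
    then have "ennreal (s z ^ (DIM('v) - DIM('m))) * ennreal ((1 / s z) ^ (DIM('v) - DIM('m))) = 1"
      using s by (metis ennreal_1 ennreal_mult' zero_le_power)
    then show ?thesis
      unfolding scaled[symmetric] mult.assoc[symmetric] by simp
  qed
  define F where "F = (\<lambda>y::'m\<times>'v. h (fst y) * indicator {y. 0 < norm (snd y) \<and> norm (snd y) < s (fst y)} y)"
  have [measurable]: "F \<in> borel_measurable borel"
    unfolding F_def borel_prod[symmetric] by measurable
  have [measurable]: "F \<in> borel_measurable (borel \<Otimes>\<^sub>M borel)"
    by (simp add: borel_prod)
  have "(\<integral>\<^sup>+x. h (Q x) * indicator {x. 0 < norm (P x) \<and> norm (P x) < s (Q x)} x \<partial>lborel)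
      = (\<integral>\<^sup>+x. F (Q x, P x) \<partial>lborel)"
    by (intro nn_integral_cong) (auto simp: F_def split: split_indicator)
  also have "\<dots> = (\<integral>\<^sup>+x. indicator C (Q x) * (\<integral>\<^sup>+z. F (z, P x) \<partial>lborel) \<partial>lborel)"
    using nn_integral_fibre[of F C] C1 by simp
  also have "\<dots> = (\<integral>\<^sup>+x. (\<integral>\<^sup>+z. indicator C (Q x) * F (z, P x) \<partial>lborel) \<partial>lborel)"
    by (intro nn_integral_cong nn_integral_cmult[symmetric]) measurable
  also have "\<dots> = (\<integral>\<^sup>+z. (\<integral>\<^sup>+x. indicator C (Q x) * F (z, P x) \<partial>lborel) \<partial>lborel)"
    by (rule lborel_pair.Fubini') measurable
  also have "\<dots> = (\<integral>\<^sup>+z. h z * (\<integral>\<^sup>+x. indicator C (Q x) * indicator {p. 0 < norm p \<and> norm p < s z} (P x) \<partial>lborel) \<partial>lborel)"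
  proof (rule nn_integral_cong)
    fix z
    have "(\<integral>\<^sup>+x. indicator C (Q x) * F (z, P x) \<partial>lborel) =
        (\<integral>\<^sup>+x. h z * (indicator C (Q x) * indicator {p. 0 < norm p \<and> norm p < s z} (P x)) \<partial>lborel)"
      by (intro nn_integral_cong) (simp add: F_def indicator_def)
    then show "(\<integral>\<^sup>+x. indicator C (Q x) * F (z, P x) \<partial>lborel) =
        h z * (\<integral>\<^sup>+x. indicator C (Q x) * indicator {p. 0 < norm p \<and> norm p < s z} (P x) \<partial>lborel)"
      by (simp add: nn_integral_cmult)
  qed
  also have "\<dots> = (\<integral>\<^sup>+z. fibre_const * (h z * ennreal (s z ^ (DIM('v) - DIM('m)))) \<partial>lborel)"
    by (intro nn_integral_cong, subst inner) (simp add: ac_simps)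
  finally show ?thesis
    by (simp add: nn_integral_cmult)
qed

subsection \<open>Tail asymptotics\<close>

text \<open>After rescaling, the domain is the fixed cone \<open>R\<close> and \<open>g\<close> is
  evaluated at points tending to \<open>J (Q x)\<close>, so dominated convergence applies. The
  majorant \<open>G (Q x)\<close> is constant along the fibres; hence
  \<open>nn_integral_cone\<close> evaluates both its integral and the limit.\<close>

lemma tail_integral_tendsto:
  fixes g :: "'v \<Rightarrow> real" and s :: "'m \<Rightarrow> real" and G :: "'m \<Rightarrow> ennreal"
  assumes g: "continuous_on UNIV g"
    and [measurable]: "s \<in> borel_measurable borel" "G \<in> borel_measurable borel"
    and s: "\<And>z. 0 \<le> s z" and \<delta>: "\<delta> > 0"
    and dom: "\<And>z p. Q p = 0 \<Longrightarrow> norm p < \<delta> * s z \<Longrightarrow> ennreal (g (J z + p)) \<le> G z"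
    and fin: "(\<integral>\<^sup>+z. G z * ennreal (s z ^ (DIM('v) - DIM('m))) \<partial>lborel) < \<infinity>"
  shows "((\<lambda>u. ennreal (u ^ (DIM('v) - DIM('m))) *
      (\<integral>\<^sup>+x. ennreal (g x) * indicator {x. 0 < norm (P x) \<and> u * norm (P x) < s (Q x)} x \<partial>lborel))
    \<longlongrightarrow> fibre_const * (\<integral>\<^sup>+z. ennreal (g (J z)) * ennreal (s z ^ (DIM('v) - DIM('m))) \<partial>lborel)) at_top"
    (is "(?f \<longlongrightarrow> ?L) at_top")
\<comment> \<open>Dominated convergence is applied along sequences, so the limit in \<open>u\<close>
  is tested on an arbitrary sequence \<open>X\<close> tending to infinity.\<close>
proof (rule tendsto_at_topI_sequentially)
  fix X :: "nat \<Rightarrow> real"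
  assume X: "filterlim X at_top sequentially"
  have g_meas [measurable]: "g \<in> borel_measurable borel"
    using g by (rule borel_measurable_continuous_onI)
  define R where "R = {x. 0 < norm (P x) \<and> norm (P x) < s (Q x)}"
  have [measurable]: "R \<in> sets borel" unfolding R_def by measurable
  have resc: "?f u = (\<integral>\<^sup>+x. ennreal (g (J (Q x) + (1/u) *\<^sub>R P x)) * indicator R x \<partial>lborel)"
    if u: "u > 0" for u
  proof -
    define F where "F = (\<lambda>y::'m\<times>'v. ennreal (g (J (fst y) + snd y)) *
      indicator {y. 0 < norm (snd y) \<and> u * norm (snd y) < s (fst y)} y)"
    have [measurable]: "F \<in> borel_measurable borel"
      unfolding F_def borel_prod[symmetric] by measurable
    have c1: "u ^ (DIM('v) - DIM('m)) * (1 / u) ^ (DIM('v) - DIM('m)) = 1"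
      using u by (simp add: power_one_over)
    have "(\<integral>\<^sup>+x. ennreal (g x) * indicator {x. 0 < norm (P x) \<and> u * norm (P x) < s (Q x)} x \<partial>lborel)
        = (\<integral>\<^sup>+x. F (Q x, P x) \<partial>lborel)"
      by (intro nn_integral_cong) (simp add: F_def decompose indicator_def)
    also have "\<dots> = ennreal ((1 / u) ^ (DIM('v) - DIM('m))) * (\<integral>\<^sup>+x. F (Q x, (1 / u) *\<^sub>R P x) \<partial>lborel)"
      using u by (intro nn_integral_scale_fibre[symmetric]) auto
    finally have "?f u = ennreal (u ^ (DIM('v) - DIM('m))) * (ennreal ((1 / u) ^ (DIM('v) - DIM('m))) *
        (\<integral>\<^sup>+x. F (Q x, (1 / u) *\<^sub>R P x) \<partial>lborel))" by (rule arg_cong)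
    also have "\<dots> = (\<integral>\<^sup>+x. F (Q x, (1 / u) *\<^sub>R P x) \<partial>lborel)"
      using u by (simp add: mult.assoc[symmetric] ennreal_mult[symmetric] c1)
    also have "\<dots> = (\<integral>\<^sup>+x. ennreal (g (J (Q x) + (1/u) *\<^sub>R P x)) * indicator R x \<partial>lborel)"
      using u by (intro nn_integral_cong) (simp add: F_def R_def indicator_def)
    finally show ?thesis .
  qed
  \<comment> \<open>Dropping the first \<open>N\<close> terms makes the domination hold for every
    index: it needs \<open>1 / X n < \<delta>\<close>.\<close>
  have "eventually (\<lambda>n. X n > max 0 (1 / \<delta>)) sequentially"
    using X unfolding filterlim_at_top_dense by blast
  then obtain N where N: "\<And>n. n \<ge> N \<Longrightarrow> X n > max 0 (1 / \<delta>)"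
    by (auto simp: eventually_sequentially)
  have N: "X (n + N) > 0" "X (n + N) > 1 / \<delta>" for n
    using N[of "n + N"] by auto
  have XN: "filterlim (\<lambda>n. X (n + N)) at_top sequentially"
    using filterlim_compose[OF X filterlim_add_const_nat_at_top] .
  have "(\<lambda>n. \<integral>\<^sup>+x. ennreal (g (J (Q x) + (1 / X (n + N)) *\<^sub>R P x)) * indicator R x \<partial>lborel)
    \<longlonglongrightarrow> (\<integral>\<^sup>+x. ennreal (g (J (Q x))) * indicator R x \<partial>lborel)"
  proof (rule nn_integral_dominated_convergence[where w="\<lambda>x. G (Q x) * indicator R x"])
    show "(\<integral>\<^sup>+x. G (Q x) * indicator R x \<partial>lborel) < \<infinity>"
      unfolding R_def using fin fibre_const_finite
      by (subst nn_integral_cone) (auto intro: s simp: ennreal_mult_less_top)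
    show "AE x in lborel. ennreal (g (J (Q x) + (1 / X (j + N)) *\<^sub>R P x)) * indicator R x \<le> G (Q x) * indicator R x" for j
    proof (intro AE_I2, cases)
      fix x assume x: "x \<in> R"
      have "1 / X (j + N) < \<delta>"
        using N[of j] \<delta> by (simp add: field_simps)
      \<comment> \<open>On the cone \<open>norm (P x) < s (Q x)\<close>, so the shrunken transversal
        part falls within the radius on which \<open>G\<close> majorises \<open>g\<close>.\<close>
      then have "1 / X (j + N) * norm (P x) < \<delta> * s (Q x)"
        using x N(1)[of j] \<delta> by (intro mult_strict_mono) (auto simp: R_def)
      then have "norm ((1 / X (j + N)) *\<^sub>R P x) < \<delta> * s (Q x)"
        using N(1)[of j] by simp
      then have "ennreal (g (J (Q x) + (1 / X (j + N)) *\<^sub>R P x)) \<le> G (Q x)"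
        by (intro dom) (simp_all add: maps_simps)
      then show "ennreal (g (J (Q x) + (1 / X (j + N)) *\<^sub>R P x)) * indicator R x \<le> G (Q x) * indicator R x"
        by (simp add: mult_right_mono)
    qed simp
    show "AE x in lborel. (\<lambda>n. ennreal (g (J (Q x) + (1 / X (n + N)) *\<^sub>R P x)) * indicator R x)
        \<longlonglongrightarrow> ennreal (g (J (Q x))) * indicator R x"
    proof (rule AE_I2)
      fix x
      have "(\<lambda>n. 1 / X (n + N)) \<longlonglongrightarrow> 0"
        using XN by (intro tendsto_divide_0[OF tendsto_const] filterlim_at_top_imp_at_infinity)
      then have "(\<lambda>n. J (Q x) + (1 / X (n + N)) *\<^sub>R P x) \<longlonglongrightarrow> J (Q x) + 0 *\<^sub>R P x"
        by (intro tendsto_intros)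
      moreover have "isCont g (J (Q x))"
        using g by (simp add: continuous_on_eq_continuous_at)
      ultimately have "(\<lambda>n. g (J (Q x) + (1 / X (n + N)) *\<^sub>R P x)) \<longlonglongrightarrow> g (J (Q x))"
        by (intro isCont_tendsto_compose[of _ g]) simp_all
      then show "(\<lambda>n. ennreal (g (J (Q x) + (1 / X (n + N)) *\<^sub>R P x)) * indicator R x)
        \<longlonglongrightarrow> ennreal (g (J (Q x))) * indicator R x"
        by (cases "x \<in> R") (auto intro: tendsto_ennrealI)
    qed
  qed measurable
  also have "(\<integral>\<^sup>+x. ennreal (g (J (Q x))) * indicator R x \<partial>lborel) = ?L"
    unfolding R_def by (subst nn_integral_cone[where h="\<lambda>z. ennreal (g (J z))"]) (auto intro: s)
  finally have "(\<lambda>n. ?f (X (n + N))) \<longlonglongrightarrow> ?L"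
    using N by (simp only: resc)
  then show "(\<lambda>n. ?f (X n)) \<longlonglongrightarrow> ?L"
    by (rule LIMSEQ_offset)
qed

section \<open>Admissible densities and the limit of the ratio of tails\<close>

text \<open>The common form of the three classes. \<open>G z\<close> stands for the supremum of the
  density over the ball of radius \<open>\<delta> * s z\<close> in the fibre above \<open>z\<close>;
  the point with \<open>0 < s z\<close> and \<open>0 < g (J z)\<close> makes the limiting constant
  positive.\<close>

definition admissible :: "('m \<Rightarrow> real) \<Rightarrow> ('v \<Rightarrow> real) \<Rightarrow> bool" where
  "admissible s g \<longleftrightarrow> continuous_on UNIV g \<and> (\<forall>x. 0 \<le> g x) \<and> (\<exists>z. 0 < s z \<and> 0 < g (J z)) \<and>
    (\<exists>\<delta>>0. \<exists>G\<in>borel_measurable borel.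
      (\<forall>z p. Q p = 0 \<longrightarrow> norm p < \<delta> * s z \<longrightarrow> ennreal (g (J z + p)) \<le> G z) \<and>
      (\<integral>\<^sup>+z. G z * ennreal (s z ^ (DIM('v) - DIM('m))) \<partial>lborel) < \<infinity>)"

definition base_integral :: "('m \<Rightarrow> real) \<Rightarrow> ('v \<Rightarrow> real) \<Rightarrow> ennreal" where
  "base_integral s g = (\<integral>\<^sup>+z. ennreal (g (J z)) * ennreal (s z ^ (DIM('v) - DIM('m))) \<partial>lborel)"

lemma admissibleE:
  assumes "admissible s g"
  obtains z \<delta> G where "continuous_on UNIV g" "\<And>x. 0 \<le> g x" "0 < s z" "0 < g (J z)" "\<delta> > 0"
    "G \<in> borel_measurable borel"
    "\<And>z p. Q p = 0 \<Longrightarrow> norm p < \<delta> * s z \<Longrightarrow> ennreal (g (J z + p)) \<le> G z"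
    "(\<integral>\<^sup>+z. G z * ennreal (s z ^ (DIM('v) - DIM('m))) \<partial>lborel) < \<infinity>"
  using assms unfolding admissible_def by blast

text \<open>Finiteness comes from the majorant at \<open>p = 0\<close>. Positivity comes from
  continuity: the integrand is positive at one point, hence on a nonempty open set.\<close>

lemma
  assumes "admissible s g" and s: "continuous_on UNIV s" "\<And>z. 0 \<le> s z"
  shows base_integral_pos: "0 < base_integral s g" and base_integral_finite: "base_integral s g < \<infinity>"
proof -
  from assms(1) obtain z0 \<delta> G where g: "continuous_on UNIV g" "\<And>x. 0 \<le> g x"
    and z0: "0 < s z0" "0 < g (J z0)" and \<delta>: "\<delta> > 0"
    and G [measurable]: "G \<in> borel_measurable borel"
    and dom: "\<And>z p. Q p = 0 \<Longrightarrow> norm p < \<delta> * s z \<Longrightarrow> ennreal (g (J z + p)) \<le> G z"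
    and fin: "(\<integral>\<^sup>+z. G z * ennreal (s z ^ (DIM('v) - DIM('m))) \<partial>lborel) < \<infinity>"
    by (rule admissibleE) blast
  have d: "DIM('v) - DIM('m) > 0" using dim_less by simp
  have "base_integral s g \<le> (\<integral>\<^sup>+z. G z * ennreal (s z ^ (DIM('v) - DIM('m))) \<partial>lborel)"
    unfolding base_integral_def
  proof (rule nn_integral_mono)
    fix z
    show "ennreal (g (J z)) * ennreal (s z ^ (DIM('v) - DIM('m))) \<le> G z * ennreal (s z ^ (DIM('v) - DIM('m)))"
    proof (cases "s z = 0")
      case True
      \<comment> \<open>Where \<open>s z = 0\<close> the strict bound on \<open>norm p\<close>
        admits no \<open>p\<close>, so \<open>G\<close> gives no information there; the weight
        vanishes instead.\<close>
      have "(0::real) ^ (DIM('v) - DIM('m)) = 0"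
        using d by (rule zero_power)
      then show ?thesis
        unfolding True by (simp only: ennreal_0 mult_zero_right order_refl)
    next
      case False
      with s(2)[of z] \<delta> have "0 < \<delta> * s z" by simp
      then show ?thesis
        using dom[of 0 z] linear_0[OF linear_Q] by (intro mult_right_mono) auto
    qed
  qed
  then show "base_integral s g < \<infinity>"
    using fin by (rule le_less_trans)
  have cont: "continuous_on UNIV (\<lambda>z. g (J z) * s z ^ (DIM('v) - DIM('m)))"
    using linear_continuous_on[of J UNIV] linear_J
    by (intro continuous_intros continuous_on_compose2[OF g(1)] s(1))
      (auto simp: linear_conv_bounded_linear)
  define S where "S = {z. 0 < g (J z) * s z ^ (DIM('v) - DIM('m))}"
  have "open S" unfolding S_def
    using cont by (intro open_Collect_less) auto
  moreover have "z0 \<in> S" using z0 by (simp add: S_def)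
  ultimately have S: "emeasure lborel S \<noteq> 0"
    by (intro emeasure_lborel_open_nonzero) auto
  have eq: "base_integral s g = (\<integral>\<^sup>+z. ennreal (g (J z) * s z ^ (DIM('v) - DIM('m))) \<partial>lborel)"
    unfolding base_integral_def using g s by (simp add: ennreal_mult)
  have [measurable]: "(\<lambda>z. g (J z) * s z ^ (DIM('v) - DIM('m))) \<in> borel_measurable borel"
    using cont by (rule borel_measurable_continuous_onI)
  show "0 < base_integral s g"
  proof (rule ccontr)
    assume "\<not> 0 < base_integral s g"
    then have "AE z in lborel. ennreal (g (J z) * s z ^ (DIM('v) - DIM('m))) = 0"
      unfolding eq by (subst (asm) zero_less_iff_neq_zero) (simp add: nn_integral_0_iff_AE)
    then have "AE z in lborel. z \<notin> S"
      by eventually_elim (simp add: S_def ennreal_eq_0_iff)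
    then have "emeasure lborel S = 0"
      using \<open>open S\<close> by (subst (asm) AE_iff_measurable[where N=S]) auto
    with S show False by simp
  qed
qed

text \<open>Multiplied by \<open>\<phi> u\<close> to the codimension, each tail probability has a
  positive finite limit, so these powers and \<open>fibre_const\<close> cancel in the quotient. The
  factor \<open>\<kappa>\<close> also cancels and adjusts \<open>base_integral\<close> to the stated
  functional. A general \<open>\<phi>\<close> accommodates a statistic that is a ratio of
  squares.\<close>

theorem tail_ratio:
  fixes T :: "'v \<Rightarrow> real" and \<phi> :: "real \<Rightarrow> real"
  assumes s: "continuous_on UNIV s" "\<And>z. 0 \<le> s z"
    and C: "\<And>g. g \<in> C \<Longrightarrow> admissible s g"
    and Kf: "\<And>g. g \<in> C \<Longrightarrow> Kf g = ennreal \<kappa> * base_integral s g" and \<kappa>: "\<kappa> > 0"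
    and \<phi>: "filterlim \<phi> at_top at_top"
    and T: "\<And>u x. u > 0 \<Longrightarrow> T x > u \<longleftrightarrow> 0 < norm (P x) \<and> \<phi> u * norm (P x) < s (Q x)"
  shows "\<exists>K :: ('v \<Rightarrow> real) \<Rightarrow> real.
    (\<forall>g\<in>C. 0 < K g \<and> ennreal (K g) = Kf g) \<and>
    (\<forall>g0\<in>C. \<forall>g1\<in>C. \<forall>(H0 :: 'w measure) (H1 :: 'w measure) (X :: 'w \<Rightarrow> 'v).
       prob_space H0 \<longrightarrow> prob_space H1 \<longrightarrow>
       distributed H0 lborel X (\<lambda>x. ennreal (g0 x)) \<longrightarrow>
       distributed H1 lborel X (\<lambda>x. ennreal (g1 x)) \<longrightarrow>
       (\<lambda>u. \<P>(w in H1. T (X w) > u) / \<P>(w in H0. T (X w) > u) - K g1 / K g0) \<in> o(\<lambda>_. 1))"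
proof -
  define I where "I = (\<lambda>g. enn2real (base_integral s g))"
  have I: "0 < I g" "ennreal (I g) = base_integral s g" if "g \<in> C" for g
    using base_integral_pos[OF C s] base_integral_finite[OF C s] that
    by (auto simp: I_def enn2real_positive_iff)
  define W where "W = enn2real fibre_const"
  have W: "0 < W" "ennreal W = fibre_const"
    using fibre_const_pos fibre_const_finite by (auto simp: W_def enn2real_positive_iff)
  have [measurable]: "s \<in> borel_measurable borel"
    using s(1) by (rule borel_measurable_continuous_onI)
  have lim: "((\<lambda>u. \<phi> u ^ (DIM('v) - DIM('m)) * \<P>(w in H. T (X w) > u)) \<longlongrightarrow> W * I g) at_top"
    if g: "g \<in> C" and "prob_space H" and D: "distributed H lborel X (\<lambda>x. ennreal (g x))" 
    for g and H :: "'w measure" and X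
  proof -
    interpret prob_space H by fact
    let ?A = "\<lambda>u. {x. 0 < norm (P x) \<and> u * norm (P x) < s (Q x)}"
    from C[OF g] obtain \<delta> G where "continuous_on UNIV g" "\<delta> > 0"
        "G \<in> borel_measurable borel"
        "\<And>z p. Q p = 0 \<Longrightarrow> norm p < \<delta> * s z \<Longrightarrow> ennreal (g (J z + p)) \<le> G z"
        "(\<integral>\<^sup>+z. G z * ennreal (s z ^ (DIM('v) - DIM('m))) \<partial>lborel) < \<infinity>"
      by (rule admissibleE) blast
    then have "((\<lambda>u. ennreal (u ^ (DIM('v) - DIM('m))) *
      (\<integral>\<^sup>+x. ennreal (g x) * indicator (?A u) x \<partial>lborel)) \<longlongrightarrow> fibre_const * base_integral s g) at_top"
      unfolding base_integral_def using s(2) by (intro tail_integral_tendsto) auto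
    then have lim: "((\<lambda>u. ennreal (\<phi> u ^ (DIM('v) - DIM('m))) *
      (\<integral>\<^sup>+x. ennreal (g x) * indicator (?A (\<phi> u)) x \<partial>lborel)) \<longlongrightarrow> ennreal (W * I g)) at_top"
      using filterlim_compose[OF _ \<phi>] I(2)[OF g] W by (simp add: ennreal_mult' I_def)
    have ev: "eventually (\<lambda>u. u > 0 \<and> \<phi> u > 0) at_top"
      using eventually_gt_at_top[of 0] \<phi>[unfolded filterlim_at_top_dense] by (auto intro: eventually_conj)
    have "((\<lambda>u. ennreal (\<phi> u ^ (DIM('v) - DIM('m)) * \<P>(w in H. T (X w) > u))) \<longlongrightarrow> ennreal (W * I g)) at_top"
    proof (rule Lim_transform_eventually[OF lim])
      show "eventually (\<lambda>u. ennreal (\<phi> u ^ (DIM('v) - DIM('m))) *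
          (\<integral>\<^sup>+x. ennreal (g x) * indicator (?A (\<phi> u)) x \<partial>lborel) =
        ennreal (\<phi> u ^ (DIM('v) - DIM('m)) * \<P>(w in H. T (X w) > u))) at_top"
        using ev
      proof eventually_elim
        fix u :: real assume u: "0 < u \<and> 0 < \<phi> u"
        have "{w \<in> space H. T (X w) > u} = X -` ?A (\<phi> u) \<inter> space H"
          using u by (auto simp: T)
        moreover have "(\<integral>\<^sup>+x. ennreal (g x) * indicator (?A (\<phi> u)) x \<partial>lborel) = emeasure H (X -` ?A (\<phi> u) \<inter> space H)"
          by (rule distributed_emeasure[OF D, symmetric]) simp
        ultimately show "ennreal (\<phi> u ^ (DIM('v) - DIM('m))) *
          (\<integral>\<^sup>+x. ennreal (g x) * indicator (?A (\<phi> u)) x \<partial>lborel) =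
          ennreal (\<phi> u ^ (DIM('v) - DIM('m)) * \<P>(w in H. T (X w) > u))"
          using u by (simp add: ennreal_mult' emeasure_eq_measure)
      qed
    qed
    \<comment> \<open>The limit descends from \<open>ennreal\<close> to the reals because the terms
      are nonnegative once \<open>\<phi> u > 0\<close>.\<close>
    then show ?thesis
      using W(1) I(1)[OF g] ev by (subst (asm) tendsto_ennreal_iff) (auto elim!: eventually_mono)
  qed
  show ?thesis
  proof (intro exI[of _ "\<lambda>g. \<kappa> * I g"] conjI ballI allI impI)
    fix g assume "g \<in> C"
    then show "0 < \<kappa> * I g" "ennreal (\<kappa> * I g) = Kf g"
      using I[of g] \<kappa> by (simp_all add: Kf ennreal_mult')
  next
    fix g0 g1 and H0 H1 :: "'w measure" and X
    assume *: "g0 \<in> C" "g1 \<in> C" "prob_space H0" "prob_space H1"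
      "distributed H0 lborel X (\<lambda>x. ennreal (g0 x))" "distributed H1 lborel X (\<lambda>x. ennreal (g1 x))"
    have "((\<lambda>u. (\<phi> u ^ (DIM('v) - DIM('m)) * \<P>(w in H1. T (X w) > u)) /
        (\<phi> u ^ (DIM('v) - DIM('m)) * \<P>(w in H0. T (X w) > u))) \<longlongrightarrow> (W * I g1) / (W * I g0)) at_top"
      using * W I(1)[of g0] by (intro tendsto_divide lim) auto
    then have "((\<lambda>u. \<P>(w in H1. T (X w) > u) / \<P>(w in H0. T (X w) > u)) \<longlongrightarrow> (W * I g1) / (W * I g0)) at_top"
    proof (rule Lim_transform_eventually)
      show "eventually (\<lambda>u. (\<phi> u ^ (DIM('v) - DIM('m)) * \<P>(w in H1. T (X w) > u)) /
        (\<phi> u ^ (DIM('v) - DIM('m)) * \<P>(w in H0. T (X w) > u)) =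
        \<P>(w in H1. T (X w) > u) / \<P>(w in H0. T (X w) > u)) at_top"
        using \<phi>[unfolded filterlim_at_top_dense, rule_format, of 0] by eventually_elim simp
    qed
    then have "((\<lambda>u. \<P>(w in H1. T (X w) > u) / \<P>(w in H0. T (X w) > u) - \<kappa> * I g1 / (\<kappa> * I g0)) \<longlongrightarrow> 0) at_top"
      using W \<kappa> by (intro LIM_zero) simp
    then show "(\<lambda>u. \<P>(w in H1. T (X w) > u) / \<P>(w in H0. T (X w) > u) - \<kappa> * I g1 / (\<kappa> * I g0)) \<in> o(\<lambda>_. 1)"
      by (intro smalloI_tendsto) auto
  qed
qed

end

section \<open>Measurability of suprema and orthogonal complements\<close>

text \<open>A supremum of continuous functions is lower semicontinuous: its strict superlevel sets
  are unions of open sets. This covers the uncountable suprema over \<xi> in the three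
  classes.\<close>

lemma borel_measurable_SUP_lsc:
  fixes f :: "'i \<Rightarrow> 'a::topological_space \<Rightarrow> ennreal"
  assumes "\<And>i. i \<in> I \<Longrightarrow> continuous_on UNIV (f i)"
  shows "(\<lambda>x. SUP i\<in>I. f i x) \<in> borel_measurable borel"
proof (rule borel_measurableI_greater)
  fix y
  have "{x. y < (SUP i\<in>I. f i x)} = (\<Union>i\<in>I. {x. y < f i x})"
    by (auto simp: less_SUP_iff)
  moreover have "open (\<Union>i\<in>I. {x. y < f i x})"
    using assms by (intro open_UN ballI open_Collect_less continuous_on_const) auto
  ultimately show "{x \<in> space borel. y < (SUP i\<in>I. f i x)} \<in> sets borel"
    by simp
qed

lemma orthogonal_comp_spanI:
  assumes "\<And>b. b \<in> B \<Longrightarrow> orthogonal b x"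
  shows "x \<in> (span B)\<^sup>\<bottom>"
  unfolding orthogonal_comp_def using assms orthogonal_to_span[of _ B x]
  by (auto simp: orthogonal_commute)

section \<open>Polar coordinates in a half plane\<close>

text \<open>Two measures agreeing on intervals suffice. On the branch
  \<open>{- pi / 2<..<pi / 2}\<close> the preimage of an interval under \<open>tan\<close> lies
  between the arctangents of its endpoints, and the density is the derivative of \<open>tan\<close>,
  so integrating it returns the length. The indicator discards all other branches.\<close>

lemma lborel_eq_distr_tan:
  "lborel = distr (density lborel (\<lambda>\<omega>. ennreal (1 / (cos \<omega>)\<^sup>2) * indicator {- pi / 2<..<pi / 2} \<omega>)) borel tan"
    (is "_ = distr ?D borel tan")
proof (rule lborel_eqI)
  have [measurable]: "tan \<in> borel_measurable (borel :: real measure)"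
    unfolding tan_def by measurable
  fix l u :: real
  assume "\<And>b. b \<in> Basis \<Longrightarrow> l \<bullet> b \<le> u \<bullet> b"
  then have "l \<le> u" by simp
  define a b where "a = arctan l" and "b = arctan u"
  have ab: "a \<le> b" "- pi / 2 < a" "b < pi / 2"
    using \<open>l \<le> u\<close> arctan_bounded[of l] arctan_bounded[of u] by (auto simp: a_def b_def arctan_le_iff)
  have cos: "cos x > 0" if "a \<le> x" "x \<le> b" for x
    using that ab by (intro cos_gt_zero_pi) auto
  have iff: "- pi / 2 < \<omega> \<and> \<omega> < pi / 2 \<and> l < tan \<omega> \<and> tan \<omega> < u \<longleftrightarrow> a < \<omega> \<and> \<omega> < b" for \<omega>
  proof -
    have "l < tan \<omega> \<longleftrightarrow> a < \<omega>" "tan \<omega> < u \<longleftrightarrow> \<omega> < b" if "- pi / 2 < \<omega>" "\<omega> < pi / 2"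
      using arctan_less_iff[of l "tan \<omega>"] arctan_less_iff[of "tan \<omega>" u] arctan_tan[of \<omega>] that
      by (auto simp: a_def b_def)
    then show ?thesis using ab by auto
  qed
  have tan_sets: "tan -` box l u \<in> sets borel"
    by (rule measurable_sets_borel[of _ borel]) simp_all
  have "emeasure (distr ?D borel tan) (box l u) = emeasure ?D (tan -` box l u)"
    by (subst emeasure_distr) simp_all
  also have "\<dots> = (\<integral>\<^sup>+\<omega>. ennreal (1 / (cos \<omega>)\<^sup>2) * indicator {- pi / 2<..<pi / 2} \<omega>
      * indicator (tan -` box l u) \<omega> \<partial>lborel)"
  proof (rule emeasure_density)
    show "tan -` box l u \<in> sets lborel"
      using tan_sets by (simp only: sets_lborel)
  qed measurable
  also have "\<dots> = (\<integral>\<^sup>+\<omega>. ennreal (1 / (cos \<omega>)\<^sup>2) * indicator {a<..<b} \<omega> \<partial>lborel)"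
    using iff by (intro nn_integral_cong) (auto simp: box_real split: split_indicator)
  \<comment> \<open>The two added endpoints are null; the fundamental theorem of calculus is then
    used on a closed interval.\<close>
  also have "\<dots> = (\<integral>\<^sup>+\<omega>. ennreal (1 / (cos \<omega>)\<^sup>2) * indicator {a..b} \<omega> \<partial>lborel)"
    using AE_lborel_singleton[of a] AE_lborel_singleton[of b]
    by (intro nn_integral_cong_AE, elim AE_mp) (auto intro!: AE_I2 split: split_indicator)
  also have "\<dots> = tan b - tan a"
    using ab(1) cos by (intro nn_integral_FTC_Icc)
      (auto intro!: derivative_eq_intros simp: power2_eq_square divide_inverse less_imp_neq[symmetric])
  finally show "emeasure (distr ?D borel tan) (box l u) = ennreal (\<Prod>b\<in>Basis. (u - l) \<bullet> b)"
    by (simp add: a_def b_def tan_arctan)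
qed simp

lemma nn_integral_tan_substitution:
  fixes f :: "real \<Rightarrow> ennreal"
  assumes [measurable]: "f \<in> borel_measurable borel"
  shows "(\<integral>\<^sup>+b. f b \<partial>lborel) =
    (\<integral>\<^sup>+\<omega>. ennreal (1 / (cos \<omega>)\<^sup>2) * indicator {- pi / 2<..<pi / 2} \<omega> * f (tan \<omega>) \<partial>lborel)"
proof -
  have [measurable]: "tan \<in> borel_measurable (borel :: real measure)"
    unfolding tan_def by measurable
  show ?thesis
    by (subst lborel_eq_distr_tan) (simp add: nn_integral_distr nn_integral_density)
qed

text \<open>Substitute \<open>b = a tan \<omega>\<close> for fixed \<open>a\<close>, and then \<open>a = r cos \<omega>\<close> for fixed \<open>\<omega>\<close>.\<close>

lemma nn_integral_polar_half_plane:
  fixes F :: "real \<times> real \<Rightarrow> ennreal"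
  assumes [measurable]: "F \<in> borel_measurable borel"
  shows "(\<integral>\<^sup>+z. F z * indicator {z. 0 < fst z} z \<partial>lborel) =
    (\<integral>\<^sup>+\<omega>\<in>{- pi / 2..pi / 2}. (\<integral>\<^sup>+r\<in>{0..}. ennreal r * F (r * cos \<omega>, r * sin \<omega>) \<partial>lborel) \<partial>lborel)"
proof -
  have [measurable]: "F \<in> borel_measurable (borel \<Otimes>\<^sub>M borel)"
    by (simp add: borel_prod)
  have [measurable]: "tan \<in> borel_measurable (borel :: real measure)"
    unfolding tan_def by measurable
  let ?S = "\<lambda>\<omega>. ennreal (1 / (cos \<omega>)\<^sup>2) * indicator {- pi / 2<..<pi / 2} \<omega>"
  have "(\<integral>\<^sup>+z. F z * indicator {z. 0 < fst z} z \<partial>lborel) =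
      (\<integral>\<^sup>+a. (\<integral>\<^sup>+b. F (a, b) * indicator {0<..} a \<partial>lborel) \<partial>lborel)"
    unfolding lborel_prod[symmetric] 
    by (subst lborel.nn_integral_fst[symmetric]) (auto intro!: nn_integral_cong split: split_indicator)
  also have "\<dots> = (\<integral>\<^sup>+a. (\<integral>\<^sup>+\<omega>. ennreal a * (?S \<omega> * F (a, a * tan \<omega>)) * indicator {0<..} a \<partial>lborel) \<partial>lborel)"
  proof (rule nn_integral_cong)
    fix a :: real
    show "(\<integral>\<^sup>+b. F (a, b) * indicator {0<..} a \<partial>lborel) =
        (\<integral>\<^sup>+\<omega>. ennreal a * (?S \<omega> * F (a, a * tan \<omega>)) * indicator {0<..} a \<partial>lborel)"
    proof (cases "a > 0")
      case True
      then have "(\<integral>\<^sup>+b. F (a, b) \<partial>lborel) = ennreal a * (\<integral>\<^sup>+t. F (a, a * t) \<partial>lborel)"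
        using nn_integral_real_affine[of "\<lambda>b. F (a, b)" a 0] by simp
      also have "\<dots> = ennreal a * (\<integral>\<^sup>+\<omega>. ?S \<omega> * F (a, a * tan \<omega>) \<partial>lborel)"
        by (subst nn_integral_tan_substitution) simp_all
      also have "\<dots> = (\<integral>\<^sup>+\<omega>. ennreal a * (?S \<omega> * F (a, a * tan \<omega>)) \<partial>lborel)"
        by (rule nn_integral_cmult[symmetric]) measurable
      finally show ?thesis using True by simp
    qed simp
  qed
  also have "\<dots> = (\<integral>\<^sup>+\<omega>. (\<integral>\<^sup>+a. ennreal a * (?S \<omega> * F (a, a * tan \<omega>)) * indicator {0<..} a \<partial>lborel) \<partial>lborel)"
    by (rule lborel_pair.Fubini'[symmetric]) measurable
  also have "\<dots> = (\<integral>\<^sup>+\<omega>. (\<integral>\<^sup>+r\<in>{0..}. ennreal r * F (r * cos \<omega>, r * sin \<omega>) \<partial>lborel) * indicator {- pi / 2<..<pi / 2} \<omega> \<partial>lborel)"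
  proof (rule nn_integral_cong)
    fix \<omega> :: real
    show "(\<integral>\<^sup>+a. ennreal a * (?S \<omega> * F (a, a * tan \<omega>)) * indicator {0<..} a \<partial>lborel) =
      (\<integral>\<^sup>+r\<in>{0..}. ennreal r * F (r * cos \<omega>, r * sin \<omega>) \<partial>lborel) * indicator {- pi / 2<..<pi / 2} \<omega>"
    proof (cases "\<omega> \<in> {- pi / 2<..<pi / 2}")
      case True
      then have c: "cos \<omega> > 0" by (intro cos_gt_zero_pi) auto
      have "(\<integral>\<^sup>+a. ennreal a * (?S \<omega> * F (a, a * tan \<omega>)) * indicator {0<..} a \<partial>lborel) =
          ennreal (cos \<omega>) * (\<integral>\<^sup>+r. ennreal (cos \<omega> * r) * (?S \<omega> * F (cos \<omega> * r, cos \<omega> * r * tan \<omega>)) * indicator {0<..} (cos \<omega> * r) \<partial>lborel)"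
        using c by (subst nn_integral_real_affine[where c="cos \<omega>" and t=0]) auto
      also have "\<dots> = (\<integral>\<^sup>+r. ennreal (cos \<omega>) * (ennreal (cos \<omega> * r) * (?S \<omega> * F (cos \<omega> * r, cos \<omega> * r * tan \<omega>)) * indicator {0<..} (cos \<omega> * r)) \<partial>lborel)"
        by (rule nn_integral_cmult[symmetric]) measurable
      also have "\<dots> = (\<integral>\<^sup>+r\<in>{0..}. ennreal r * F (r * cos \<omega>, r * sin \<omega>) \<partial>lborel)"
      proof (rule nn_integral_cong)
        fix r :: real
        show "ennreal (cos \<omega>) * (ennreal (cos \<omega> * r) * (?S \<omega> * F (cos \<omega> * r, cos \<omega> * r * tan \<omega>)) * indicator {0<..} (cos \<omega> * r))
            = ennreal r * F (r * cos \<omega>, r * sin \<omega>) * indicator {0..} r"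
        proof (cases "r > 0")
          case r: True
          \<comment> \<open>The three Jacobians meet here: \<open>cos \<omega>\<close> from
            \<open>a = r cos \<omega>\<close>, the value of \<open>a\<close> from
            \<open>b = a t\<close>, and \<open>1 / (cos \<omega>)\<^sup>2\<close> from
            \<open>t = tan \<omega>\<close>. Their product is the polar factor
            \<open>r\<close>.\<close>
          have "cos \<omega> * (cos \<omega> * r) * (1 / (cos \<omega>)\<^sup>2) = r"
            using c by (simp add: power2_eq_square)
          then have "ennreal (cos \<omega>) * ennreal (cos \<omega> * r) * ennreal (1 / (cos \<omega>)\<^sup>2) = ennreal r"
            using c r by (simp flip: ennreal_mult)
          moreover have pt: "(cos \<omega> * r, cos \<omega> * r * tan \<omega>) = (r * cos \<omega>, r * sin \<omega>)"
            using c by (simp add: tan_def)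
          ultimately show ?thesis
            unfolding pt using True r c by (simp add: mult.assoc[symmetric])
        next
          case False
          \<comment> \<open>At \<open>r = 0\<close> the factor \<open>ennreal r\<close> vanishes;
            for negative \<open>r\<close> both indicators do.\<close>
          then show ?thesis
            using c by (cases "r = 0") (auto simp: zero_less_mult_iff)
        qed
      qed
      finally show ?thesis using True by simp
    next
      case False
      then show ?thesis by simp
    qed
  qed
  also have "\<dots> = (\<integral>\<^sup>+\<omega>\<in>{- pi / 2..pi / 2}. (\<integral>\<^sup>+r\<in>{0..}. ennreal r * F (r * cos \<omega>, r * sin \<omega>) \<partial>lborel) \<partial>lborel)"
    using AE_lborel_singleton[of "- pi / 2"] AE_lborel_singleton[of "pi / 2"]
    by (intro nn_integral_cong_AE, elim AE_mp) (auto intro!: AE_I2 split: split_indicator)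
  finally show ?thesis .
qed

section \<open>The three statistics\<close>

lemma inner_diag_dir: "x \<bullet> diag_dir = (\<Sum>i\<in>UNIV. x $ i) / sqrt (real CARD('k))"
  for x :: "real ^ 'k"
  by (simp add: inner_vec_def diag_dir_def sum_divide_distrib)

lemma inner_diag_dir_self [simp]: "(diag_dir :: real ^ 'k) \<bullet> diag_dir = 1"
  by (simp add: inner_vec_def diag_dir_def)

lemma sample_mean_eq: "sample_mean x = (x \<bullet> diag_dir) / sqrt (real CARD('k))"
  for x :: "real ^ 'k"
  by (simp add: sample_mean_def inner_diag_dir)

text \<open>All coordinates of \<open>(x \<bullet> diag_dir) *\<^sub>R diag_dir\<close> equal the
  sample mean, so the sum of squared deviations is the squared norm of the part of \<open>x\<close>
  orthogonal to the diagonal.\<close>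

lemma sample_var_eq:
  "sample_var x = (norm (x - (x \<bullet> diag_dir) *\<^sub>R diag_dir))\<^sup>2 / (real CARD('k) - 1)"
  for x :: "real ^ 'k"
  unfolding power2_norm_eq_inner sample_var_def
  by (simp add: inner_vec_def sample_mean_eq diag_dir_def power2_eq_square)

lemma sample_sd_eq:
  "sample_sd x = norm (x - (x \<bullet> diag_dir) *\<^sub>R diag_dir) / sqrt (real CARD('k) - 1)"
  for x :: "real ^ 'k"
  by (simp add: sample_sd_def sample_var_eq real_sqrt_divide)

text \<open>Brings a quotient into the form required by \<open>tail_ratio\<close>. For
  \<open>q = 0\<close> division yields \<open>0\<close>, which does not exceed \<open>u\<close>; as
  \<open>u\<close> is positive, a negative \<open>a\<close> can be replaced by \<open>0\<close>,
  which keeps the cone radius nonnegative.\<close>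

lemma less_divide_iff_cone:
  fixes u c q a :: real
  assumes "0 < u" "0 < c" "0 \<le> q"
  shows "u < c * a / q \<longleftrightarrow> 0 < q \<and> u * q < c * max 0 a"
proof (cases "q = 0")
  case False
  with assms have q: "0 < q" by simp
  show ?thesis
  proof (cases "a < 0")
    case True
    have "\<not> u * q < c * a" "\<not> u * q < c * 0"
      using mult_pos_pos[OF assms(1) q] mult_pos_neg[OF assms(2) True] by simp_all
    then show ?thesis
      using q True by (simp add: pos_less_divide_eq)
  next
    case False
    then show ?thesis
      using q by (simp add: pos_less_divide_eq)
  qed
qed (use assms in auto)

text \<open>The classes allow positivity of \<open>g\<close> at a boundary point, where the cone
  radius vanishes; continuity moves that point into the interior.\<close>

lemma continuous_pos_right:
  fixes h :: "real \<Rightarrow> real"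
  assumes "continuous_on UNIV h" "0 < h x"
  obtains r where "0 < h r" "x < r"
proof -
  have "(h \<longlongrightarrow> h x) (at_right x)"
    using assms(1) by (metis UNIV_I at_le continuous_on_def subset_UNIV tendsto_mono)
  then have "eventually (\<lambda>r. h r > 0 \<and> r > x) (at_right x)"
    using assms(2) by (intro eventually_conj order_tendstoD(1) eventually_at_right_less)
  then show thesis
    using that eventually_happens'[of "at_right x"] by auto
qed

text \<open>For negative \<open>r\<close> the weight is \<open>0 ^ d\<close>, which is
  \<open>0\<close> since \<open>d > 0\<close>; this confines the integral to the half line.\<close>

lemma nn_integral_half_line_split:
  fixes f :: "real \<Rightarrow> ennreal"
  assumes [measurable]: "f \<in> borel_measurable borel" and c: "c > 0" and d: "d > 0"
  shows "(\<integral>\<^sup>+r. f r * ennreal ((c * max 0 r) ^ d) \<partial>lborel) =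
    ennreal (c ^ d) * (\<integral>\<^sup>+r\<in>{0..}. ennreal (r ^ d) * f r \<partial>lborel)"
proof -
  have "(\<integral>\<^sup>+r. f r * ennreal ((c * max 0 r) ^ d) \<partial>lborel) =
      (\<integral>\<^sup>+r. ennreal (c ^ d) * (ennreal (r ^ d) * f r * indicator {0..} r) \<partial>lborel)"
    using c d by (intro nn_integral_cong)
      (auto simp: power_mult_distrib ennreal_mult max_def ac_simps zero_power split: split_indicator)
  then show ?thesis by (simp add: nn_integral_cmult)
qed

section \<open>The one-sample t-statistic\<close>

lemma fibration_one:
  assumes "CARD('n) \<ge> 2"
  shows "fibration (\<lambda>x :: real ^ 'n. x \<bullet> diag_dir) (\<lambda>r. r *\<^sub>R diag_dir)"
  using assms by unfold_locales (auto intro!: linearI simp: algebra_simps inner_add_left)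

theorem tail_ratio_one:
  assumes n: "CARD('n) \<ge> 2"
  shows "\<exists>K :: (real ^ 'n \<Rightarrow> real) \<Rightarrow> real.
    (\<forall>g\<in>class_one. 0 < K g \<and> ennreal (K g) = K_one g) \<and>
    (\<forall>g0\<in>class_one. \<forall>g1\<in>class_one.
       \<forall>(H0 :: 'w measure) (H1 :: 'w measure) (X :: 'w \<Rightarrow> real ^ 'n).
         prob_space H0 \<longrightarrow> prob_space H1 \<longrightarrow>
         distributed H0 lborel X (\<lambda>x. ennreal (g0 x)) \<longrightarrow>
         distributed H1 lborel X (\<lambda>x. ennreal (g1 x)) \<longrightarrow>
         (\<lambda>u. \<P>(w in H1. t_one (X w) > u) / \<P>(w in H0. t_one (X w) > u) - K g1 / K g0)
           \<in> o(\<lambda>_. 1))"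
proof -
  interpret fibration "\<lambda>x :: real ^ 'n. x \<bullet> diag_dir" "\<lambda>r. r *\<^sub>R diag_dir"
    using n by (rule fibration_one)
  \<comment> \<open>With the divisor of the sample variance absorbed in \<open>c\<close>, the
    statistic is \<open>c * (x \<bullet> diag_dir) / norm (P x)\<close>.\<close>
  define c where "c = sqrt (real CARD('n) - 1)"
  have c: "c > 0" using n by (simp add: c_def)
  define d where "d = CARD('n) - 1"
  have d: "d > 0" "DIM(real ^ 'n) - DIM(real) = d" using n by (simp_all add: d_def)
  define s where "s = (\<lambda>r :: real. c * max 0 r)"
  have s: "continuous_on UNIV s" "\<And>r. 0 \<le> s r"
    using c by (auto simp: s_def intro!: continuous_intros)
  \<comment> \<open>The prefactor of \<open>K_one\<close> divided by \<open>c ^ d\<close>, because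
    \<open>base_integral\<close> carries the factor \<open>c ^ d\<close> coming from
    \<open>s\<close>.\<close>
  define \<kappa> where "\<kappa> = 2 * pi powr (real CARD('n) / 2) / Gamma (real CARD('n) / 2) / c ^ d"
  have \<kappa>: "\<kappa> > 0"
    using c n by (auto simp: \<kappa>_def intro!: divide_pos_pos mult_pos_pos Gamma_real_pos)
  have adm: "admissible s g" if "g \<in> class_one" for g
  proof -
    from that obtain x \<epsilon> where g: "continuous_on UNIV g" "\<And>x. 0 \<le> g x"
      and x: "x \<ge> 0" "g (x *\<^sub>R diag_dir) > 0" and \<epsilon>: "\<epsilon> > 0"
      and fin: "(\<integral>\<^sup>+ r\<in>{0..}. ennreal (r ^ d) *
          (SUP \<xi>\<in>{\<xi>. norm \<xi> < \<epsilon> \<and> \<xi> \<in> (span {diag_dir})\<^sup>\<bottom>}.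
             ennreal (g (r *\<^sub>R (diag_dir + \<xi>)))) \<partial>lborel) < \<infinity>"
      unfolding class_one_def continuous_density_def d_def by auto
    define G where "G = (\<lambda>r. SUP \<xi>\<in>{\<xi>. norm \<xi> < \<epsilon> \<and> \<xi> \<in> (span {diag_dir})\<^sup>\<bottom>}.
             ennreal (g (r *\<^sub>R (diag_dir + \<xi>))))"
    have fin': "(\<integral>\<^sup>+ r\<in>{0..}. ennreal (r ^ d) * G r \<partial>lborel) < \<infinity>"
      using fin by (simp only: G_def)
    have [measurable]: "G \<in> borel_measurable borel"
      unfolding G_def by (intro borel_measurable_SUP_lsc continuous_on_ennreal
        continuous_on_compose2[OF g(1)] continuous_intros) auto
    have "continuous_on UNIV (\<lambda>r. g (r *\<^sub>R diag_dir))"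
      by (intro continuous_on_compose2[OF g(1)] continuous_intros) auto
    then obtain r where r: "g (r *\<^sub>R diag_dir) > 0" "r > x"
      using x(2) by (rule continuous_pos_right)
    show ?thesis
      unfolding admissible_def
    proof (intro conjI g(1) allI g(2))
      show "\<exists>z. 0 < s z \<and> 0 < g (z *\<^sub>R diag_dir)"
        using r x c by (intro exI[of _ r]) (simp add: s_def)
      show "\<exists>\<delta>>0. \<exists>G\<in>borel_measurable borel.
        (\<forall>z p. p \<bullet> diag_dir = 0 \<longrightarrow> norm p < \<delta> * s z \<longrightarrow> ennreal (g (z *\<^sub>R diag_dir + p)) \<le> G z) \<and>
        (\<integral>\<^sup>+z. G z * ennreal (s z ^ (DIM(real ^ 'n) - DIM(real))) \<partial>lborel) < \<infinity>"
      \<comment> \<open>Dividing by \<open>c\<close> cancels the factor in \<open>s\<close>: the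
        bound reads \<open>norm p < \<epsilon> * z\<close> with \<open>z > 0\<close>, so
        \<open>p /\<^sub>R z\<close> is one of the \<xi> in the supremum.\<close>
      proof (intro exI[of _ "\<epsilon> / c"] bexI[of _ G] conjI allI impI)
        fix z :: real and p :: "real ^ 'n"
        assume p: "p \<bullet> diag_dir = 0" and "norm p < \<epsilon> / c * s z"
        then have lt: "norm p < \<epsilon> * max 0 z" using c by (simp add: s_def)
        then have z: "z > 0" by (cases "z > 0") (auto simp: max_def split: if_splits)
        have "norm (p /\<^sub>R z) < \<epsilon>"
          using lt z by (simp add: field_simps)
        moreover have "p /\<^sub>R z \<in> (span {diag_dir})\<^sup>\<bottom>"
          using p by (intro orthogonal_comp_spanI) (simp add: orthogonal_def inner_commute)
        moreover have "z *\<^sub>R diag_dir + p = z *\<^sub>R (diag_dir + p /\<^sub>R z)"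
          using z by (simp add: scaleR_add_right)
        ultimately show "ennreal (g (z *\<^sub>R diag_dir + p)) \<le> G z"
          unfolding G_def by (intro SUP_upper2[of "p /\<^sub>R z"]) auto
      next
        show "(\<integral>\<^sup>+z. G z * ennreal (s z ^ (DIM(real ^ 'n) - DIM(real))) \<partial>lborel) < \<infinity>"
          unfolding d(2) s_def using fin' c d(1)
          by (subst nn_integral_half_line_split) (auto simp: ennreal_mult_less_top)
      qed (use \<epsilon> c in auto)
    qed
  qed
  show ?thesis
  proof (rule tail_ratio[where s=s and C=class_one and \<kappa>=\<kappa> and \<phi>="\<lambda>u. u"])
    fix g :: "real ^ 'n \<Rightarrow> real"
    assume "g \<in> class_one"
    then show "admissible s g" by (rule adm)
    from \<open>g \<in> class_one\<close> have g: "continuous_on UNIV g" "\<And>x. 0 \<le> g x"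
      by (auto simp: class_one_def continuous_density_def)
    have [measurable]: "g \<in> borel_measurable borel"
      using g(1) by (rule borel_measurable_continuous_onI)
    have "ennreal \<kappa> * base_integral s g = ennreal \<kappa> * (ennreal (c ^ d) *
        (\<integral>\<^sup>+r\<in>{0..}. ennreal (r ^ d) * ennreal (g (r *\<^sub>R diag_dir)) \<partial>lborel))"
      unfolding base_integral_def d(2) s_def using c d(1)
      by (subst nn_integral_half_line_split) auto
    also have "\<dots> = ennreal (\<kappa> * c ^ d) *
        (\<integral>\<^sup>+r\<in>{0..}. ennreal (r ^ d) * ennreal (g (r *\<^sub>R diag_dir)) \<partial>lborel)"
      using c \<kappa> by (simp add: ennreal_mult mult.assoc)
    also have "(\<integral>\<^sup>+r\<in>{0..}. ennreal (r ^ d) * ennreal (g (r *\<^sub>R diag_dir)) \<partial>lborel) =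
        (\<integral>\<^sup>+r\<in>{0..}. ennreal (r ^ d * g (r *\<^sub>R diag_dir)) \<partial>lborel)"
      using g(2) by (intro nn_integral_cong) (simp add: ennreal_mult split: split_indicator)
    also have "\<kappa> * c ^ d = 2 * pi powr (real CARD('n) / 2) / Gamma (real CARD('n) / 2)"
      using c by (simp add: \<kappa>_def)
    finally show "K_one g = ennreal \<kappa> * base_integral s g"
      by (simp only: K_one_def Let_def d_def)
  next
    fix u :: real and x :: "real ^ 'n"
    assume u: "u > 0"
    define q where "q = norm (P x)"
    define a where "a = x \<bullet> diag_dir"
    have "t_one x = a / (q / c)"
      by (simp add: t_one_def sample_mean_eq sample_sd_eq q_def a_def P_def c_def)
    then have T: "t_one x = c * a / q" by simp
    show "t_one x > u \<longleftrightarrow> 0 < norm (P x) \<and> u * norm (P x) < s (x \<bullet> diag_dir)"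
      unfolding T s_def q_def[symmetric] a_def[symmetric]
      using u c by (intro less_divide_iff_cone) (simp_all add: q_def)
  qed (use s \<kappa> filterlim_ident in auto)
qed

section \<open>The two-sample t-statistic\<close>

text \<open>In polar coordinates the weight is \<open>(c * (r * cos \<omega>)) ^ d\<close>, and the
  Jacobian \<open>r\<close> raises the power of \<open>r\<close> by one. For
  \<open>d = CARD('a) + CARD('b) - 2\<close> these are the weights in \<open>class_two\<close> and
  \<open>K_two\<close>.\<close>

lemma nn_integral_half_plane_split:
  fixes f :: "real \<times> real \<Rightarrow> ennreal"
  assumes [measurable]: "f \<in> borel_measurable borel" and c: "c > 0" and d: "d > 0"
  shows "(\<integral>\<^sup>+z. f z * ennreal ((c * max 0 (fst z)) ^ d) \<partial>lborel) =
    ennreal (c ^ d) * (\<integral>\<^sup>+\<omega>\<in>{- pi / 2..pi / 2}. ennreal (cos \<omega> ^ d) *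
      (\<integral>\<^sup>+r\<in>{0..}. ennreal (r ^ Suc d) * f (r * cos \<omega>, r * sin \<omega>) \<partial>lborel) \<partial>lborel)"
proof -
  have [measurable]: "f \<in> borel_measurable (borel \<Otimes>\<^sub>M borel)"
    by (simp add: borel_prod)
  have [measurable]: "(fst :: real \<times> real \<Rightarrow> real) \<in> borel_measurable borel"
    by (intro borel_measurable_continuous_onI continuous_intros)
  have "(\<integral>\<^sup>+z. f z * ennreal ((c * max 0 (fst z)) ^ d) \<partial>lborel) =
      (\<integral>\<^sup>+z. (f z * ennreal ((c * fst z) ^ d)) * indicator {z. 0 < fst z} z \<partial>lborel)"
    using d by (intro nn_integral_cong) (simp add: max_def split: split_indicator)
  also have "\<dots> = (\<integral>\<^sup>+\<omega>\<in>{- pi / 2..pi / 2}.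
      (\<integral>\<^sup>+r\<in>{0..}. ennreal r * (f (r * cos \<omega>, r * sin \<omega>) * ennreal ((c * (r * cos \<omega>)) ^ d)) \<partial>lborel) \<partial>lborel)"
    by (subst nn_integral_polar_half_plane) simp_all
  also have "\<dots> = (\<integral>\<^sup>+\<omega>. ennreal (c ^ d) * (ennreal (cos \<omega> ^ d) *
      (\<integral>\<^sup>+r\<in>{0..}. ennreal (r ^ Suc d) * f (r * cos \<omega>, r * sin \<omega>) \<partial>lborel) * indicator {- pi / 2..pi / 2} \<omega>) \<partial>lborel)"
  proof (rule nn_integral_cong)
    fix \<omega> :: real
    show "(\<integral>\<^sup>+r\<in>{0..}. ennreal r * (f (r * cos \<omega>, r * sin \<omega>) * ennreal ((c * (r * cos \<omega>)) ^ d)) \<partial>lborel) *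
        indicator {- pi / 2..pi / 2} \<omega> =
      ennreal (c ^ d) * (ennreal (cos \<omega> ^ d) *
        (\<integral>\<^sup>+r\<in>{0..}. ennreal (r ^ Suc d) * f (r * cos \<omega>, r * sin \<omega>) \<partial>lborel) * indicator {- pi / 2..pi / 2} \<omega>)"
    proof (cases "\<omega> \<in> {- pi / 2..pi / 2}")
      case True
      then have cos: "0 \<le> cos \<omega>" by (intro cos_ge_zero) auto
      have "(\<integral>\<^sup>+r\<in>{0..}. ennreal r * (f (r * cos \<omega>, r * sin \<omega>) * ennreal ((c * (r * cos \<omega>)) ^ d)) \<partial>lborel) =
          (\<integral>\<^sup>+r. ennreal (c ^ d * cos \<omega> ^ d) * (ennreal (r ^ Suc d) * f (r * cos \<omega>, r * sin \<omega>) * indicator {0..} r) \<partial>lborel)"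
        using c cos by (intro nn_integral_cong)
          (auto simp: power_mult_distrib ennreal_mult ac_simps split: split_indicator)
      also have "\<dots> = ennreal (c ^ d * cos \<omega> ^ d) *
          (\<integral>\<^sup>+r\<in>{0..}. ennreal (r ^ Suc d) * f (r * cos \<omega>, r * sin \<omega>) \<partial>lborel)"
        by (rule nn_integral_cmult) measurable
      finally show ?thesis
        using True c cos by (simp add: ennreal_mult mult.assoc)
    qed simp
  qed
  finally show ?thesis
    by (simp add: nn_integral_cmult)
qed

lemma sum_UNIV_sum:
  fixes f :: "'a::finite + 'b::finite \<Rightarrow> 'c::comm_monoid_add"
  shows "(\<Sum>i\<in>UNIV. f i) = (\<Sum>i\<in>UNIV. f (Inl i)) + (\<Sum>j\<in>UNIV. f (Inr j))"
  unfolding UNIV_Plus_UNIV[symmetric] by (subst sum.Plus) simp_all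

lemma inner_sum_vec:
  fixes x y :: "real ^ ('a::finite + 'b::finite)"
  shows "x \<bullet> y = sample_fst x \<bullet> sample_fst y + sample_snd x \<bullet> sample_snd y"
  by (simp add: inner_vec_def sample_fst_def sample_snd_def sum_UNIV_sum)

lemma sample_parts [simp]:
  "sample_fst block_dir1 = diag_dir" "sample_snd block_dir1 = 0"
  "sample_fst block_dir2 = 0" "sample_snd block_dir2 = diag_dir"
  by (simp_all add: sample_fst_def sample_snd_def block_dir1_def block_dir2_def diag_dir_def vec_eq_iff)

lemma sample_parts_linear:
  "sample_fst (x - y) = sample_fst x - sample_fst y" "sample_snd (x - y) = sample_snd x - sample_snd y"
  "sample_fst (r *\<^sub>R x) = r *\<^sub>R sample_fst x" "sample_snd (r *\<^sub>R x) = r *\<^sub>R sample_snd x"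
  by (simp_all add: sample_fst_def sample_snd_def vec_eq_iff)

lemma inner_block_dir [simp]:
  "x \<bullet> block_dir1 = sample_fst x \<bullet> diag_dir" "x \<bullet> block_dir2 = sample_snd x \<bullet> diag_dir"
  by (simp_all add: inner_sum_vec)

lemma block_dir_orthonormal:
  "block_dir1 \<bullet> (block_dir1 :: real ^ ('a::finite + 'b::finite)) = 1"
  "block_dir2 \<bullet> (block_dir2 :: real ^ ('a::finite + 'b::finite)) = 1"
  "block_dir1 \<bullet> (block_dir2 :: real ^ ('a::finite + 'b::finite)) = 0"
  "block_dir2 \<bullet> (block_dir1 :: real ^ ('a::finite + 'b::finite)) = 0"
  by simp_all

text \<open>The angle \<omega> is the ordinary polar angle in the frame \<open>circle_dir 0\<close>,
  \<open>circle_dir (pi / 2)\<close>, which is the frame of block directions rotated by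
  \<open>omega0\<close>.\<close>

lemma circle_dir_decompose:
  "circle_dir \<omega> = cos \<omega> *\<^sub>R circle_dir 0 + sin \<omega> *\<^sub>R circle_dir (pi / 2)"
  by (simp add: circle_dir_def cos_diff sin_diff algebra_simps)

lemma circle_dir_orthonormal:
  "circle_dir 0 \<bullet> (circle_dir 0 :: real ^ ('a::finite + 'b::finite)) = 1"
  "circle_dir (pi / 2) \<bullet> (circle_dir (pi / 2) :: real ^ ('a::finite + 'b::finite)) = 1"
  "circle_dir 0 \<bullet> (circle_dir (pi / 2) :: real ^ ('a::finite + 'b::finite)) = 0"
  "circle_dir (pi / 2) \<bullet> (circle_dir 0 :: real ^ ('a::finite + 'b::finite)) = 0"
  by (simp_all add: circle_dir_def cos_diff sin_diff inner_add_left inner_add_right inner_diff_left inner_diff_right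
    block_dir_orthonormal power2_eq_square[symmetric] del: inner_block_dir)

text \<open>Inverts the rotation. Thus a vector orthogonal to the rotated frame is orthogonal to
  both block directions, and both frames define the same projection.\<close>

lemma block_dir_eq_circle_dir:
  fixes \<omega>0 :: real
  assumes "\<omega>0 = omega0 CARD('a) CARD('b)"
  shows "(block_dir1 :: real ^ ('a::finite + 'b::finite)) = cos \<omega>0 *\<^sub>R circle_dir 0 + sin \<omega>0 *\<^sub>R circle_dir (pi / 2)"
    "(block_dir2 :: real ^ ('a::finite + 'b::finite)) = - sin \<omega>0 *\<^sub>R circle_dir 0 + cos \<omega>0 *\<^sub>R circle_dir (pi / 2)"
proof -
  have "(cos \<omega>0 * cos \<omega>0) *\<^sub>R x + (sin \<omega>0 * sin \<omega>0) *\<^sub>R x = x" for x :: "real ^ ('a + 'b)"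
    by (simp flip: scaleR_add_left power2_eq_square)
  then show "(block_dir1 :: real ^ ('a + 'b)) = cos \<omega>0 *\<^sub>R circle_dir 0 + sin \<omega>0 *\<^sub>R circle_dir (pi / 2)"
    "(block_dir2 :: real ^ ('a + 'b)) = - sin \<omega>0 *\<^sub>R circle_dir 0 + cos \<omega>0 *\<^sub>R circle_dir (pi / 2)"
    by (simp_all add: circle_dir_def cos_diff sin_diff assms[symmetric] scaleR_add_right scaleR_diff_right mult.commute add_ac)
qed

lemma cos_sin_omega0:
  assumes "0 < n2"
  shows "cos (omega0 n1 n2) = sqrt (real n2 / real (n1 + n2))"
    and "sin (omega0 n1 n2) = sqrt (real n1 / real (n1 + n2))"
proof -
  have *: "0 \<le> sqrt (real n2 / real (n1 + n2))" "sqrt (real n2 / real (n1 + n2)) \<le> 1"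
    using assms by (simp_all add: divide_le_eq)
  have ge: "- 1 \<le> sqrt (real n2 / real (n1 + n2))"
    using *(1) by linarith
  show "cos (omega0 n1 n2) = sqrt (real n2 / real (n1 + n2))"
    unfolding omega0_def using ge *(2) by (rule cos_arccos)
  have "1 - real n2 / real (n1 + n2) = real n1 / real (n1 + n2)"
    using assms by (simp add: field_simps)
  then show "sin (omega0 n1 n2) = sqrt (real n1 / real (n1 + n2))"
    unfolding omega0_def using sin_arccos[OF ge *(2)] by (simp del: of_nat_add)
qed

text \<open>This explains the angle \<open>omega0\<close>: its cosine and sine are proportional to
  the coefficients of the two block directions in the difference of means, so only the first vector
  of the rotated frame enters.\<close>

lemma mean_difference_eq:
  fixes x :: "real ^ ('a::finite + 'b::finite)"
  shows "sample_mean (sample_fst x) - sample_mean (sample_snd x) =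
    sqrt (1 / real CARD('a) + 1 / real CARD('b)) * (x \<bullet> circle_dir 0)"
proof -
  have eq: "sqrt (1 / real a + 1 / real b) * sqrt (real b / real (a + b)) = 1 / sqrt (real a)"
     "sqrt (1 / real a + 1 / real b) * sqrt (real a / real (a + b)) = 1 / sqrt (real b)"
    if "a > 0" "b > 0" for a b
  proof -
    have "(1 / real a + 1 / real b) * (real b / real (a + b)) = 1 / real a"
      "(1 / real a + 1 / real b) * (real a / real (a + b)) = 1 / real b"
      using that by (simp_all add: divide_simps) 
    then show "sqrt (1 / real a + 1 / real b) * sqrt (real b / real (a + b)) = 1 / sqrt (real a)"
     "sqrt (1 / real a + 1 / real b) * sqrt (real a / real (a + b)) = 1 / sqrt (real b)"
      unfolding real_sqrt_mult[symmetric] by (simp_all only: real_sqrt_divide real_sqrt_one)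
  qed
  have "x \<bullet> circle_dir 0 = sqrt (real CARD('b) / real (CARD('a) + CARD('b))) * (sample_fst x \<bullet> diag_dir) -
      sqrt (real CARD('a) / real (CARD('a) + CARD('b))) * (sample_snd x \<bullet> diag_dir)"
    unfolding circle_dir_def by (simp add: inner_add_right inner_diff_right cos_sin_omega0 del: of_nat_add)
  then show ?thesis
    by (simp only: right_diff_distrib mult.assoc[symmetric] eq zero_less_card_finite sample_mean_eq) simp
qed

lemma fibration_two:
  assumes "CARD('a::finite) \<ge> 2" "CARD('b::finite) \<ge> 2"
  shows "fibration (\<lambda>x :: real ^ ('a + 'b). (x \<bullet> circle_dir 0, x \<bullet> circle_dir (pi / 2)))
    (\<lambda>z. fst z *\<^sub>R circle_dir 0 + snd z *\<^sub>R circle_dir (pi / 2))"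
  using assms by unfold_locales
    (auto intro!: linearI simp: algebra_simps inner_add_left circle_dir_orthonormal)

theorem tail_ratio_two:
  assumes n: "CARD('a::finite) \<ge> 2" "CARD('b::finite) \<ge> 2"
  shows "\<exists>K :: (real ^ ('a + 'b) \<Rightarrow> real) \<Rightarrow> real.
    (\<forall>g\<in>class_two. 0 < K g \<and> ennreal (K g) = K_two g) \<and>
    (\<forall>g0\<in>class_two. \<forall>g1\<in>class_two.
       \<forall>(H0 :: 'w measure) (H1 :: 'w measure) (X :: 'w \<Rightarrow> real ^ ('a + 'b)).
         prob_space H0 \<longrightarrow> prob_space H1 \<longrightarrow>
         distributed H0 lborel X (\<lambda>x. ennreal (g0 x)) \<longrightarrow>
         distributed H1 lborel X (\<lambda>x. ennreal (g1 x)) \<longrightarrow>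
         (\<lambda>u. \<P>(w in H1. t_two (X w) > u) / \<P>(w in H0. t_two (X w) > u) - K g1 / K g0)
           \<in> o(\<lambda>_. 1))"
proof -
  define E where "E = (circle_dir 0 :: real ^ ('a + 'b))"
  define F where "F = (circle_dir (pi / 2) :: real ^ ('a + 'b))"
  interpret fibration "\<lambda>x :: real ^ ('a + 'b). (x \<bullet> E, x \<bullet> F)" "\<lambda>z. fst z *\<^sub>R E + snd z *\<^sub>R F"
    unfolding E_def F_def using n by (rule fibration_two)
  have circle: "circle_dir \<omega> = cos \<omega> *\<^sub>R E + sin \<omega> *\<^sub>R F" for \<omega>
    unfolding E_def F_def by (rule circle_dir_decompose)
  \<comment> \<open>The square of \<open>c\<close> is the divisor of the pooled variance.\<close>
  define c where "c = sqrt (real CARD('a) + real CARD('b) - 2)"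
  have c: "c > 0" using n by (simp add: c_def)
  define d where "d = CARD('a) + CARD('b) - 2"
  have d: "d > 0" "DIM(real ^ ('a + 'b)) - DIM(real \<times> real) = d" "CARD('a) + CARD('b) - 1 = Suc d"
    using n by (simp_all add: d_def)
  define s where "s = (\<lambda>z :: real \<times> real. c * max 0 (fst z))"
  have s: "continuous_on UNIV s" "\<And>r. 0 \<le> s r"
    using c by (auto simp: s_def intro!: continuous_intros)
  define k where "k = 2 * pi powr ((real CARD('a) + real CARD('b) - 1) / 2) *
    ((real CARD('a) - 1) / pool_alpha CARD('a) CARD('b)) powr ((real CARD('a) - 1) / 2) *
    ((real CARD('b) - 1) / pool_beta CARD('a) CARD('b)) powr ((real CARD('b) - 1) / 2) *
    (1 / real CARD('a) + 1 / real CARD('b)) powr ((real CARD('a) + real CARD('b) - 2) / 2) /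
    (Gamma ((real CARD('a) + real CARD('b) - 1) / 2) *
      (real CARD('a) + real CARD('b) - 2) powr ((real CARD('a) + real CARD('b) - 2) / 2))"
  have recip: "1 / real CARD('a) + 1 / real CARD('b) > 0"
    by (intro add_pos_pos) simp_all
  then have pool: "pool_alpha CARD('a) CARD('b) > 0" "pool_beta CARD('a) CARD('b) > 0"
    using n unfolding pool_alpha_def pool_beta_def
    by (intro mult_pos_pos divide_pos_pos; simp)+
  have k: "k > 0"
    unfolding k_def using n recip pool
    by (intro divide_pos_pos mult_pos_pos Gamma_real_pos) (simp_all add: powr_gt_zero divide_eq_0_iff)
  define \<kappa> where "\<kappa> = k / c ^ d"
  have \<kappa>: "\<kappa> > 0" using c k by (simp add: \<kappa>_def)
  have adm: "admissible s g" if "g \<in> class_two" for g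
  proof -
    from that obtain r \<omega> \<epsilon> where g: "continuous_on UNIV g" "\<And>x. 0 \<le> g x"
      and r: "r \<ge> 0" "\<omega> \<in> {- pi / 2..pi / 2}" "g (r *\<^sub>R circle_dir \<omega>) > 0" and \<epsilon>: "\<epsilon> > 0"
      and fin: "(\<integral>\<^sup>+ \<omega>\<in>{- pi / 2..pi / 2}. ennreal (cos \<omega> ^ d) *
          (\<integral>\<^sup>+ r\<in>{0..}. ennreal (r ^ Suc d) *
             (SUP \<xi>\<in>{\<xi>. norm \<xi> < \<epsilon> \<and> \<xi> \<in> (span {block_dir1, block_dir2})\<^sup>\<bottom>}.
                ennreal (g (r *\<^sub>R (circle_dir \<omega> + \<xi>)))) \<partial>lborel) \<partial>lborel) < \<infinity>"
      unfolding class_two_def continuous_density_def d_def[symmetric] d(3) by auto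
    \<comment> \<open>The factor \<open>norm z\<close> is the radius in polar coordinates, so
      \<open>G\<close> there becomes the supremum over
      \<open>r *\<^sub>R (circle_dir \<omega> + \<xi>)\<close> in \<open>class_two\<close>.\<close>
    define G where "G = (\<lambda>z. SUP \<xi>\<in>{\<xi>. norm \<xi> < \<epsilon> \<and> \<xi> \<in> (span {block_dir1, block_dir2})\<^sup>\<bottom>}.
             ennreal (g (fst z *\<^sub>R E + snd z *\<^sub>R F + norm z *\<^sub>R \<xi>)))"
    have [measurable]: "G \<in> borel_measurable borel"
      unfolding G_def by (intro borel_measurable_SUP_lsc continuous_on_ennreal
        continuous_on_compose2[OF g(1)] continuous_intros) auto
    have G_polar: "G (r * cos \<omega>, r * sin \<omega>) =
        (SUP \<xi>\<in>{\<xi>. norm \<xi> < \<epsilon> \<and> \<xi> \<in> (span {block_dir1, block_dir2})\<^sup>\<bottom>}.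
          ennreal (g (r *\<^sub>R (circle_dir \<omega> + \<xi>))))" if "r \<ge> 0" for r \<omega>
    proof -
      have "(r * cos \<omega>)\<^sup>2 + (r * sin \<omega>)\<^sup>2 = r\<^sup>2"
        by (simp add: power_mult_distrib flip: distrib_left)
      then have "norm (r * cos \<omega>, r * sin \<omega>) = r"
        using that by (simp add: norm_Pair)
      then show ?thesis
        by (simp add: G_def circle scaleR_add_right)
    qed
    have "(\<integral>\<^sup>+ r\<in>{0..}. ennreal (r ^ Suc d) * G (r * cos \<omega>, r * sin \<omega>) \<partial>lborel) =
        (\<integral>\<^sup>+ r\<in>{0..}. ennreal (r ^ Suc d) *
          (SUP \<xi>\<in>{\<xi>. norm \<xi> < \<epsilon> \<and> \<xi> \<in> (span {block_dir1, block_dir2})\<^sup>\<bottom>}.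
                ennreal (g (r *\<^sub>R (circle_dir \<omega> + \<xi>)))) \<partial>lborel)" for \<omega>
      by (intro nn_integral_cong) (simp add: G_polar split: split_indicator)
    then have fin': "(\<integral>\<^sup>+ \<omega>\<in>{- pi / 2..pi / 2}. ennreal (cos \<omega> ^ d) *
        (\<integral>\<^sup>+ r\<in>{0..}. ennreal (r ^ Suc d) * G (r * cos \<omega>, r * sin \<omega>) \<partial>lborel) \<partial>lborel) < \<infinity>"
      using fin by (simp only:)
    define a b where "a = r * cos \<omega>" and "b = r * sin \<omega>"
    have a: "a \<ge> 0" unfolding a_def using r by (intro mult_nonneg_nonneg cos_ge_zero) auto
    have "r *\<^sub>R circle_dir \<omega> = a *\<^sub>R E + b *\<^sub>R F"
      by (simp add: circle a_def b_def scaleR_add_right)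
    with r have ab: "g (a *\<^sub>R E + b *\<^sub>R F) > 0" by simp
    \<comment> \<open>The given point may have first coordinate \<open>a = 0\<close>, where
      \<open>s\<close> vanishes. It is moved along \<open>E\<close> with \<open>b\<close>
      fixed.\<close>
    have "continuous_on UNIV (\<lambda>t. g (t *\<^sub>R E + b *\<^sub>R F))"
      by (intro continuous_on_compose2[OF g(1)] continuous_intros) auto
    then obtain t where t: "g (t *\<^sub>R E + b *\<^sub>R F) > 0" "t > a"
      using ab by (rule continuous_pos_right)
    show ?thesis
      unfolding admissible_def
    proof (intro conjI g(1) allI g(2))
      show "\<exists>z. 0 < s z \<and> 0 < g (fst z *\<^sub>R E + snd z *\<^sub>R F)"
        using t a c by (intro exI[of _ "(t, b)"]) (simp add: s_def)
      show "\<exists>\<delta>>0. \<exists>G\<in>borel_measurable borel.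
        (\<forall>z p. (p \<bullet> E, p \<bullet> F) = 0 \<longrightarrow> norm p < \<delta> * s z \<longrightarrow>
          ennreal (g ((fst z *\<^sub>R E + snd z *\<^sub>R F) + p)) \<le> G z) \<and>
        (\<integral>\<^sup>+z. G z * ennreal (s z ^ (DIM(real ^ ('a + 'b)) - DIM(real \<times> real))) \<partial>lborel) < \<infinity>"
      proof (intro exI[of _ "\<epsilon> / c"] bexI[of _ G] conjI allI impI)
        fix z :: "real \<times> real" and p :: "real ^ ('a + 'b)"
        assume "(p \<bullet> E, p \<bullet> F) = 0" and lt: "norm p < \<epsilon> / c * s z"
        then have p: "p \<bullet> E = 0" "p \<bullet> F = 0" by (simp_all add: zero_prod_def)
        from lt have lt: "norm p < \<epsilon> * max 0 (fst z)" using c by (simp add: s_def)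
        then have "0 < fst z" by (cases "0 < fst z") (auto simp: max_def split: if_splits)
        \<comment> \<open>The cone bounds \<open>p\<close> in terms of \<open>fst z\<close>, whereas
          the supremum in \<open>G\<close> runs over a ball scaled by \<open>norm z\<close>; the
          inequality puts the former inside the latter.\<close>
        moreover have "fst z \<le> norm z"
          using norm_fst_le[of "fst z" "snd z"] by simp
        ultimately have z: "norm z > 0" "max 0 (fst z) \<le> norm z"
          by linarith+
        have "norm p < \<epsilon> * norm z"
          using lt z \<epsilon> by (meson less_le_trans less_imp_le mult_left_mono)
        then have "norm (p /\<^sub>R norm z) < \<epsilon>"
          using z by (simp add: field_simps)
        moreover have "p /\<^sub>R norm z \<in> (span {block_dir1, block_dir2})\<^sup>\<bottom>"
          using p by (intro orthogonal_comp_spanI)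
            (auto simp: orthogonal_def block_dir_eq_circle_dir[OF refl] E_def[symmetric] F_def[symmetric]
              inner_add_right inner_diff_right inner_commute[of _ p])
        moreover have "(fst z *\<^sub>R E + snd z *\<^sub>R F) + p = fst z *\<^sub>R E + snd z *\<^sub>R F + norm z *\<^sub>R (p /\<^sub>R norm z)"
          using z by simp
        ultimately show "ennreal (g ((fst z *\<^sub>R E + snd z *\<^sub>R F) + p)) \<le> G z"
          unfolding G_def by (intro SUP_upper2[of "p /\<^sub>R norm z"]) auto
      next
        show "(\<integral>\<^sup>+z. G z * ennreal (s z ^ (DIM(real ^ ('a + 'b)) - DIM(real \<times> real))) \<partial>lborel) < \<infinity>"
          unfolding d(2) s_def using fin' c d(1)
          by (subst nn_integral_half_plane_split) (auto simp: ennreal_mult_less_top)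
      qed (use \<epsilon> c in auto)
    qed
  qed
  show ?thesis
  proof (rule tail_ratio[where s=s and C=class_two and \<kappa>=\<kappa> and \<phi>="\<lambda>u. u"])
    fix g :: "real ^ ('a + 'b) \<Rightarrow> real"
    assume "g \<in> class_two"
    then show "admissible s g" by (rule adm)
    from \<open>g \<in> class_two\<close> have g: "continuous_on UNIV g" "\<And>x. 0 \<le> g x"
      by (auto simp: class_two_def continuous_density_def)
    have meas: "(\<lambda>z. ennreal (g (fst z *\<^sub>R E + snd z *\<^sub>R F))) \<in> borel_measurable borel"
      by (intro borel_measurable_continuous_onI continuous_on_ennreal
        continuous_on_compose2[OF g(1)] continuous_intros) auto
    have pt: "(r * cos \<omega>) *\<^sub>R E + (r * sin \<omega>) *\<^sub>R F = r *\<^sub>R circle_dir \<omega>" for r \<omega>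
      by (simp add: circle scaleR_add_right)
    have "ennreal \<kappa> * base_integral s g = ennreal \<kappa> * (ennreal (c ^ d) *
        (\<integral>\<^sup>+\<omega>\<in>{- pi / 2..pi / 2}. ennreal (cos \<omega> ^ d) *
          (\<integral>\<^sup>+r\<in>{0..}. ennreal (r ^ Suc d) * ennreal (g (r *\<^sub>R circle_dir \<omega>)) \<partial>lborel) \<partial>lborel))"
      unfolding base_integral_def d(2) s_def nn_integral_half_plane_split[OF meas c d(1)] fst_conv snd_conv pt ..
    also have "\<dots> = ennreal (\<kappa> * c ^ d) *
        (\<integral>\<^sup>+\<omega>\<in>{- pi / 2..pi / 2}. ennreal (cos \<omega> ^ d) *
          (\<integral>\<^sup>+r\<in>{0..}. ennreal (r ^ Suc d) * ennreal (g (r *\<^sub>R circle_dir \<omega>)) \<partial>lborel) \<partial>lborel)"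
      using c \<kappa> by (simp add: ennreal_mult mult.assoc)
    also have "(\<lambda>\<omega>. \<integral>\<^sup>+r\<in>{0..}. ennreal (r ^ Suc d) * ennreal (g (r *\<^sub>R circle_dir \<omega>)) \<partial>lborel) =
        (\<lambda>\<omega>. \<integral>\<^sup>+r\<in>{0..}. ennreal (r ^ Suc d * g (r *\<^sub>R circle_dir \<omega>)) \<partial>lborel)"
      using g(2) by (intro ext nn_integral_cong) (simp add: ennreal_mult split: split_indicator)
    also have "\<kappa> * c ^ d = k"
      using c by (simp add: \<kappa>_def)
    finally show "K_two g = ennreal \<kappa> * base_integral s g"
      by (simp only: K_two_def Let_def d_def[symmetric] d(3) k_def)
  next
    fix u :: real and x :: "real ^ ('a + 'b)"
    assume u: "u > 0"
    define q where "q = norm (P x)"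
    define a where "a = x \<bullet> E"
    define \<omega>0 where "\<omega>0 = omega0 CARD('a) CARD('b)"
    define y1 where "y1 = sample_fst x - (sample_fst x \<bullet> diag_dir) *\<^sub>R diag_dir"
    define y2 where "y2 = sample_snd x - (sample_snd x \<bullet> diag_dir) *\<^sub>R diag_dir"
    \<comment> \<open>Rewritten in the block directions, which span the same plane as
      \<open>E\<close> and \<open>F\<close>, the projection \<open>P\<close> centres each of the two
      samples separately.\<close>
    have parts: "sample_fst (P x) = y1" "sample_snd (P x) = y2"
    proof -
      define A B where "A = x \<bullet> E" and "B = x \<bullet> F"
      define c0 s0 where "c0 = cos \<omega>0" and "s0 = sin \<omega>0"
      have "c0\<^sup>2 + s0\<^sup>2 = 1" by (simp add: c0_def s0_def)
      \<comment> \<open>Rotating \<open>(A, B)\<close> by the angle and back is the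
        identity.\<close>
      then have coeff: "(c0 * A + s0 * B) * c0 - (c0 * B - s0 * A) * s0 = A"
        "(c0 * A + s0 * B) * s0 + (c0 * B - s0 * A) * c0 = B"
        by algebra+
      have dirs: "block_dir1 = c0 *\<^sub>R E + s0 *\<^sub>R F" "block_dir2 = c0 *\<^sub>R F - s0 *\<^sub>R E"
        using block_dir_eq_circle_dir[OF \<omega>0_def] by (simp_all add: c0_def s0_def E_def F_def)
      have "(x \<bullet> block_dir1) *\<^sub>R block_dir1 + (x \<bullet> block_dir2) *\<^sub>R block_dir2 =
          ((c0 * A + s0 * B) * c0 - (c0 * B - s0 * A) * s0) *\<^sub>R E +
          ((c0 * A + s0 * B) * s0 + (c0 * B - s0 * A) * c0) *\<^sub>R F"
        unfolding dirs by (simp add: A_def B_def inner_add_right inner_diff_right algebra_simps)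
      then have "(x \<bullet> E) *\<^sub>R E + (x \<bullet> F) *\<^sub>R F =
          (x \<bullet> block_dir1) *\<^sub>R block_dir1 + (x \<bullet> block_dir2) *\<^sub>R block_dir2"
        unfolding coeff by (simp only: A_def B_def)
      then have "P x = x - (x \<bullet> block_dir1) *\<^sub>R block_dir1 - (x \<bullet> block_dir2) *\<^sub>R block_dir2"
        by (simp add: P_def diff_diff_eq)
      then show "sample_fst (P x) = y1" "sample_snd (P x) = y2"
        by (simp_all add: sample_parts_linear y1_def y2_def)
    qed
    have q2: "q\<^sup>2 = (norm y1)\<^sup>2 + (norm y2)\<^sup>2"
      unfolding q_def power2_norm_eq_inner inner_sum_vec[of "P x" "P x"] parts ..
    let ?R = "1 / real CARD('a) + 1 / real CARD('b)"
    \<comment> \<open>The weights are such that the divisors of the two sample variances cancel,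
      leaving the same factor \<open>?R / c\<^sup>2\<close> for both samples.\<close>
    have "pool_alpha CARD('a) CARD('b) * sample_var (sample_fst x) = ?R * ((norm y1)\<^sup>2 / c\<^sup>2)"
      "pool_beta CARD('a) CARD('b) * sample_var (sample_snd x) = ?R * ((norm y2)\<^sup>2 / c\<^sup>2)"
      using n by (simp_all add: pool_alpha_def pool_beta_def sample_var_eq y1_def y2_def c_def)
    then have "pool_alpha CARD('a) CARD('b) * sample_var (sample_fst x) +
        pool_beta CARD('a) CARD('b) * sample_var (sample_snd x) = ?R * (q / c)\<^sup>2"
      by (simp only: q2 power_divide add_divide_distrib distrib_left)
    then have "t_two x = sqrt ?R * a / (sqrt ?R * (q / c))"
      using c by (simp only: t_two_def mean_difference_eq a_def E_def real_sqrt_mult)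
        (simp add: q_def)
    then have T: "t_two x = c * a / q"
      using recip by simp
    show "t_two x > u \<longleftrightarrow> 0 < norm (P x) \<and> u * norm (P x) < s (x \<bullet> E, x \<bullet> F)"
      unfolding T s_def q_def[symmetric] a_def[symmetric] fst_conv
      using u c by (intro less_divide_iff_cone) (simp_all add: q_def)
  qed (use s \<kappa> filterlim_ident in auto)
qed

section \<open>The F-statistic\<close>

text \<open>The base keeps the whole first sample together with the diagonal component of the
  second, so the transversal part is the centred second sample, of codimension
  \<open>CARD('b) - 1\<close>.\<close>

lemma fibration_F:
  assumes "CARD('b) \<ge> 2"
  shows "fibration (\<lambda>z :: (real ^ 'a) \<times> (real ^ 'b). (fst z, snd z \<bullet> diag_dir))
    (\<lambda>y. (fst y, snd y *\<^sub>R diag_dir))"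
  using assms by unfold_locales (auto intro!: linearI simp: algebra_simps inner_add_left)

lemma continuous_on_sample_sd [continuous_intros]:
  "continuous_on S f \<Longrightarrow> continuous_on S (\<lambda>x. sample_sd (f x :: real ^ 'k))"
  unfolding sample_sd_eq divide_inverse by (intro continuous_intros)

lemma sample_sd_nonneg: "CARD('k) \<ge> 2 \<Longrightarrow> 0 \<le> sample_sd x" for x :: "real ^ 'k"
  by (simp add: sample_sd_eq)

theorem tail_ratio_F:
  assumes n: "CARD('a) \<ge> 2" "CARD('b) \<ge> 2"
  shows "\<exists>K :: ((real ^ 'a) \<times> (real ^ 'b) \<Rightarrow> real) \<Rightarrow> real.
    (\<forall>g\<in>class_F. 0 < K g \<and> ennreal (K g) = K_F g) \<and>
    (\<forall>g0\<in>class_F. \<forall>g1\<in>class_F.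
       \<forall>(H0 :: 'w measure) (H1 :: 'w measure) (X :: 'w \<Rightarrow> (real ^ 'a) \<times> (real ^ 'b)).
         prob_space H0 \<longrightarrow> prob_space H1 \<longrightarrow>
         distributed H0 lborel X (\<lambda>x. ennreal (g0 x)) \<longrightarrow>
         distributed H1 lborel X (\<lambda>x. ennreal (g1 x)) \<longrightarrow>
         (\<lambda>u. \<P>(w in H1. f_stat (X w) > u) / \<P>(w in H0. f_stat (X w) > u) - K g1 / K g0)
           \<in> o(\<lambda>_. 1))"
proof -
  interpret fibration "\<lambda>z :: (real ^ 'a) \<times> (real ^ 'b). (fst z, snd z \<bullet> diag_dir)"
    "\<lambda>y. (fst y, snd y *\<^sub>R diag_dir)"
    using n(2) by (rule fibration_F)
  define c where "c = sqrt (real CARD('b) - 1)"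
  have c: "c > 0" using n by (simp add: c_def)
  define d where "d = CARD('b) - 1"
  have d: "d > 0" "DIM((real ^ 'a) \<times> (real ^ 'b)) - DIM((real ^ 'a) \<times> real) = d"
    using n by (simp_all add: d_def)
  define s where "s = (\<lambda>y :: (real ^ 'a) \<times> real. c * sample_sd (fst y))"
  have s: "continuous_on UNIV s" "\<And>r. 0 \<le> s r"
    using c sample_sd_nonneg[OF n(1)] by (auto simp: s_def intro!: continuous_intros)
  define k where "k = Gamma ((real CARD('a) - 1) / 2) *
    (pi * (real CARD('a) - 1)) powr ((real CARD('b) - 1) / 2) /
    Gamma ((real CARD('a) + real CARD('b) - 2) / 2)"
  have k: "k > 0"
    using n by (auto simp: k_def intro!: divide_pos_pos mult_pos_pos Gamma_real_pos)
  define \<kappa> where "\<kappa> = k / c ^ d"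
  have \<kappa>: "\<kappa> > 0" using c k by (simp add: \<kappa>_def)
  have split: "(\<integral>\<^sup>+y. f y * ennreal (s y ^ d) \<partial>lborel) =
      ennreal (c ^ d) * (\<integral>\<^sup>+x. ennreal (sample_sd x ^ d) * (\<integral>\<^sup>+r. f (x, r) \<partial>lborel) \<partial>lborel)"
    if [measurable]: "f \<in> borel_measurable borel" for f :: "(real ^ 'a) \<times> real \<Rightarrow> ennreal"
  proof -
    have [measurable]: "f \<in> borel_measurable (borel \<Otimes>\<^sub>M borel)"
      by (simp add: borel_prod)
    have [measurable]: "sample_sd \<in> borel_measurable (borel :: (real ^ 'a) measure)"
      by (intro borel_measurable_continuous_onI continuous_intros)
    have "(\<integral>\<^sup>+y. f y * ennreal (s y ^ d) \<partial>lborel) =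
        (\<integral>\<^sup>+x. (\<integral>\<^sup>+r. f (x, r) * ennreal ((c * sample_sd x) ^ d) \<partial>lborel) \<partial>lborel)"
      unfolding lborel_prod[symmetric] s_def by (subst lborel.nn_integral_fst[symmetric]) simp_all
    also have "\<dots> = (\<integral>\<^sup>+x. ennreal (c ^ d) * (ennreal (sample_sd x ^ d) * (\<integral>\<^sup>+r. f (x, r) \<partial>lborel)) \<partial>lborel)"
      using c sample_sd_nonneg[OF n(1)]
      by (intro nn_integral_cong, subst nn_integral_multc)
        (simp_all add: power_mult_distrib ennreal_mult ac_simps)
    finally show ?thesis
      by (simp add: nn_integral_cmult)
  qed
  have adm: "admissible s g" if "g \<in> class_F" for g
  proof -
    from that obtain x r \<epsilon> where g: "continuous_on UNIV g" "\<And>x. 0 \<le> g x"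
      and x: "sample_sd x * g (x, r *\<^sub>R diag_dir) > 0" and \<epsilon>: "\<epsilon> > 0"
      and fin: "(\<integral>\<^sup>+ x. ennreal (sample_sd x ^ d) *
          (\<integral>\<^sup>+ r. (SUP \<xi>\<in>{\<xi>. norm \<xi> < \<epsilon> \<and> \<xi> \<in> (span {diag_dir})\<^sup>\<bottom>}.
                ennreal (g (x, r *\<^sub>R diag_dir + sample_sd x *\<^sub>R \<xi>))) \<partial>(lborel :: real measure))
          \<partial>lborel) < \<infinity>"
      unfolding class_F_def continuous_density_def d_def by auto
    define G where "G = (\<lambda>y. SUP \<xi>\<in>{\<xi>. norm \<xi> < \<epsilon> \<and> \<xi> \<in> (span {diag_dir})\<^sup>\<bottom>}.
             ennreal (g (fst y, snd y *\<^sub>R diag_dir + sample_sd (fst y) *\<^sub>R \<xi>)))"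
    have fin': "(\<integral>\<^sup>+ x. ennreal (sample_sd x ^ d) * (\<integral>\<^sup>+ r. G (x, r) \<partial>lborel) \<partial>lborel) < \<infinity>"
      using fin by (simp only: G_def fst_conv snd_conv)
    have [measurable]: "G \<in> borel_measurable borel"
      unfolding G_def by (intro borel_measurable_SUP_lsc continuous_on_ennreal
        continuous_on_compose2[OF g(1)] continuous_intros) auto
    show ?thesis
      unfolding admissible_def
    proof (intro conjI g(1) allI g(2))
      show "\<exists>y. 0 < s y \<and> 0 < g (fst y, snd y *\<^sub>R diag_dir)"
        using x c sample_sd_nonneg[OF n(1), of x]
        by (intro exI[of _ "(x, r)"]) (auto simp: s_def zero_less_mult_iff)
      show "\<exists>\<delta>>0. \<exists>G\<in>borel_measurable borel.
        (\<forall>y p. (fst p, snd p \<bullet> diag_dir) = 0 \<longrightarrow> norm p < \<delta> * s y \<longrightarrow>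
          ennreal (g ((fst y, snd y *\<^sub>R diag_dir) + p)) \<le> G y) \<and>
        (\<integral>\<^sup>+y. G y * ennreal (s y ^ (DIM((real ^ 'a) \<times> (real ^ 'b)) - DIM((real ^ 'a) \<times> real))) \<partial>lborel) < \<infinity>"
      \<comment> \<open>As \<open>s\<close> is \<open>c\<close> times \<open>sample_sd\<close>, the
        bound on the second component of \<open>p\<close> is \<open>\<epsilon> * t\<close>; dividing
        that component by \<open>t\<close> yields a \<xi> of the supremum.\<close>
      proof (intro exI[of _ "\<epsilon> / c"] bexI[of _ G] conjI allI impI)
        fix y :: "(real ^ 'a) \<times> real" and p :: "(real ^ 'a) \<times> (real ^ 'b)"
        define t where "t = sample_sd (fst y)"
        assume "(fst p, snd p \<bullet> diag_dir) = 0" and "norm p < \<epsilon> / c * s y"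
        moreover obtain p1 p2 where "p = (p1, p2)" by (cases p)
        ultimately have p: "p = (0, p2)" "p2 \<bullet> diag_dir = 0" and lt: "norm p2 < \<epsilon> * t"
          using c by (auto simp: s_def t_def zero_prod_def)
        have "0 < \<epsilon> * t"
          using lt by (rule le_less_trans[OF norm_ge_zero])
        then have t: "t > 0" using \<epsilon> by (simp add: zero_less_mult_iff)
        have "norm (p2 /\<^sub>R t) < \<epsilon>"
          using lt t by (simp add: field_simps)
        moreover have "p2 /\<^sub>R t \<in> (span {diag_dir})\<^sup>\<bottom>"
          using p by (intro orthogonal_comp_spanI) (simp add: orthogonal_def inner_commute)
        moreover have "(fst y, snd y *\<^sub>R diag_dir) + p = (fst y, snd y *\<^sub>R diag_dir + t *\<^sub>R (p2 /\<^sub>R t))"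
          using t p by simp
        ultimately show "ennreal (g ((fst y, snd y *\<^sub>R diag_dir) + p)) \<le> G y"
          unfolding G_def t_def by (intro SUP_upper2[of "p2 /\<^sub>R sample_sd (fst y)"]) auto
      next
        show "(\<integral>\<^sup>+y. G y * ennreal (s y ^ (DIM((real ^ 'a) \<times> (real ^ 'b)) - DIM((real ^ 'a) \<times> real))) \<partial>lborel) < \<infinity>"
          unfolding d(2) using fin' by (subst split) (auto simp: ennreal_mult_less_top)
      qed (use \<epsilon> c in auto)
    qed
  qed
  show ?thesis
  \<comment> \<open>The statistic is a ratio of squared lengths, so the length of the transversal
    part is compared at scale \<open>sqrt u\<close>.\<close>
  proof (rule tail_ratio[where s=s and C=class_F and \<kappa>=\<kappa> and \<phi>=sqrt])
    fix g :: "(real ^ 'a) \<times> (real ^ 'b) \<Rightarrow> real"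
    assume "g \<in> class_F"
    then show "admissible s g" by (rule adm)
    from \<open>g \<in> class_F\<close> have g: "continuous_on UNIV g"
      by (auto simp: class_F_def continuous_density_def)
    have meas: "(\<lambda>y. ennreal (g (fst y, snd y *\<^sub>R diag_dir))) \<in> borel_measurable borel"
      by (intro borel_measurable_continuous_onI continuous_on_ennreal
        continuous_on_compose2[OF g] continuous_intros) auto
    have "ennreal \<kappa> * base_integral s g = ennreal \<kappa> * (ennreal (c ^ d) *
        (\<integral>\<^sup>+x. ennreal (sample_sd x ^ d) * (\<integral>\<^sup>+r. ennreal (g (x, r *\<^sub>R diag_dir)) \<partial>lborel) \<partial>lborel))"
      unfolding base_integral_def d(2) split[OF meas] by simp
    also have "\<dots> = ennreal (\<kappa> * c ^ d) *
        (\<integral>\<^sup>+x. ennreal (sample_sd x ^ d) * (\<integral>\<^sup>+r. ennreal (g (x, r *\<^sub>R diag_dir)) \<partial>lborel) \<partial>lborel)"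
      using c \<kappa> by (simp add: ennreal_mult mult.assoc)
    also have "\<kappa> * c ^ d = k"
      using c by (simp add: \<kappa>_def)
    finally show "K_F g = ennreal \<kappa> * base_integral s g"
      by (simp only: K_F_def Let_def d_def k_def)
  next
    fix u :: real and z :: "(real ^ 'a) \<times> (real ^ 'b)"
    assume u: "u > 0"
    define q where "q = norm (P z)"
    define t where "t = sample_sd (fst z)"
    have t: "t \<ge> 0" "sample_var (fst z) = t\<^sup>2"
      using n(1) by (simp_all add: t_def sample_sd_def sample_var_eq)
    have "P z = (0, snd z - (snd z \<bullet> diag_dir) *\<^sub>R diag_dir)"
      by (cases z) (simp add: P_def)
    then have v: "sample_var (snd z) = q\<^sup>2 / c\<^sup>2"
      using n(2) by (simp add: q_def sample_var_eq c_def norm_Pair)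
    show "f_stat z > u \<longleftrightarrow> 0 < norm (P z) \<and> sqrt u * norm (P z) < s (fst z, snd z \<bullet> diag_dir)"
      unfolding q_def[symmetric] s_def fst_conv t_def[symmetric]
    \<comment> \<open>For \<open>q = 0\<close> the denominator vanishes and the statistic has the
      value \<open>0\<close>, so the event fails, in agreement with \<open>0 < q\<close>.\<close>
    proof (cases "q = 0")
      case False
      then have q: "q > 0" by (simp add: q_def)
      have "f_stat z > u \<longleftrightarrow> u * q\<^sup>2 < (c * t)\<^sup>2"
        using q c by (simp add: f_stat_def t(2) v field_simps)
      also have "\<dots> \<longleftrightarrow> (sqrt u * q)\<^sup>2 < (c * t)\<^sup>2"
        using u by (simp add: power_mult_distrib)
      also have "\<dots> \<longleftrightarrow> sqrt u * q < c * t"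
        using t c q u by (simp add: not_le[symmetric])
      finally show "f_stat z > u \<longleftrightarrow> 0 < q \<and> sqrt u * q < c * t" using q by simp
    qed (use u in \<open>auto simp: f_stat_def v\<close>)
  qed (use s \<kappa> in \<open>auto intro: sqrt_at_top\<close>)
qed

theorem theorem1p1:
  shows
   "(CARD('n) \<ge> 2 \<longrightarrow>
       (\<exists>K :: (real ^ 'n \<Rightarrow> real) \<Rightarrow> real.
          (\<forall>g\<in>class_one. 0 < K g \<and> ennreal (K g) = K_one g) \<and>
          (\<forall>g0\<in>class_one. \<forall>g1\<in>class_one.
             \<forall>(H0 :: 'w measure) (H1 :: 'w measure) (X :: 'w \<Rightarrow> real ^ 'n).
               prob_space H0 \<longrightarrow> prob_space H1 \<longrightarrow>
               distributed H0 lborel X (\<lambda>x. ennreal (g0 x)) \<longrightarrow>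
               distributed H1 lborel X (\<lambda>x. ennreal (g1 x)) \<longrightarrow>
               (\<lambda>u. \<P>(w in H1. t_one (X w) > u) / \<P>(w in H0. t_one (X w) > u) - K g1 / K g0)
                 \<in> o(\<lambda>_. 1)))) \<and>
    (CARD('a) \<ge> 2 \<and> CARD('b) \<ge> 2 \<longrightarrow>
       (\<exists>K :: (real ^ ('a::finite + 'b::finite) \<Rightarrow> real) \<Rightarrow> real.
          (\<forall>g\<in>class_two. 0 < K g \<and> ennreal (K g) = K_two g) \<and>
          (\<forall>g0\<in>class_two. \<forall>g1\<in>class_two.
             \<forall>(H0 :: 'w measure) (H1 :: 'w measure) (X :: 'w \<Rightarrow> real ^ ('a::finite + 'b::finite)).
               prob_space H0 \<longrightarrow> prob_space H1 \<longrightarrow>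
               distributed H0 lborel X (\<lambda>x. ennreal (g0 x)) \<longrightarrow>
               distributed H1 lborel X (\<lambda>x. ennreal (g1 x)) \<longrightarrow>
               (\<lambda>u. \<P>(w in H1. t_two (X w) > u) / \<P>(w in H0. t_two (X w) > u) - K g1 / K g0)
                 \<in> o(\<lambda>_. 1)))) \<and>
    (CARD('a) \<ge> 2 \<and> CARD('b) \<ge> 2 \<longrightarrow>
       (\<exists>K :: ((real ^ 'a) \<times> (real ^ 'b) \<Rightarrow> real) \<Rightarrow> real.
          (\<forall>g\<in>class_F. 0 < K g \<and> ennreal (K g) = K_F g) \<and>
          (\<forall>g0\<in>class_F. \<forall>g1\<in>class_F.
             \<forall>(H0 :: 'w measure) (H1 :: 'w measure) (X :: 'w \<Rightarrow> (real ^ 'a) \<times> (real ^ 'b)).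
               prob_space H0 \<longrightarrow> prob_space H1 \<longrightarrow>
               distributed H0 lborel X (\<lambda>x. ennreal (g0 x)) \<longrightarrow>
               distributed H1 lborel X (\<lambda>x. ennreal (g1 x)) \<longrightarrow>
               (\<lambda>u. \<P>(w in H1. f_stat (X w) > u) / \<P>(w in H0. f_stat (X w) > u) - K g1 / K g0)
                 \<in> o(\<lambda>_. 1))))"
  by (intro conjI impI tail_ratio_one tail_ratio_two tail_ratio_F; (elim conjE)?; assumption)

end
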